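(* There exists an absolute constant $c_6$ such that the following holds. Let an RPTree-Max be built on a finite data set $S \subset \mathbb{R}^D$ of doubling dimension $d$. Then for a given (fixed) ball $B$ of radius $R$, with probability greater than $1 - 1/4$ (over the randomization in constructing the tree), $B$ is completely contained in an RPTree-Max cell of radius no more than $c_6 \cdot R d \sqrt{d}\log d$.
   Context: Doubling dimension: the doubling dimension of a set $T \subset \mathbb{R}^D$ is the smallest integer $d$ such that for every closed ball $B(x,r)$, $B(x,r) \cap T$ can be covered by $2^d$ balls of radius $r/2$. RPTree-Max: a random binary tree of cells built recursively on $S$; the root cell contains all of $S$. A cell $C$ (containing data $S\cap C$) is split as follows: pick an arbitrary point $x_0 \in S \cap C$ and set $\tilde\Delta = \max\{\|x_0-y\| : y \in S\cap C\}$; choose a random direction $v \sim N(0,(1/D) I_D)$; independently choose $\delta$ uniformly at random in $[-6\tilde\Delta/\sqrt{D},\, 6\tilde\Delta/\sqrt{D}]$; a point $y \in S \cap C$ goes to the left child if $y\cdot v < \mathrm{median}\{z \cdot v : z \in S \cap C\} + \delta$ and to the right child otherwise. Random choices at different splits are independent. The radius of a cell is the radius of the smallest ball containing its data.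
   Formalization: The bound uses log(max(2,d)) in place of log d, since at d = 1 the stated bound is 0 and fails for two points in B; "B is contained in a cell" means that all data points of S in B lie in the cell, since the claim for the full ball in R^D fails for large D. *)

theory Defs
  imports "HOL-Probability.Probability" "HOL-Library.Sublist" "HOL-Library.Multiset"
begin

text \<open>
  The constant of the theorem must not depend on the ambient dimension \<open>D\<close>, so \<open>D\<close> is a number and
  not a type: a point of $R^D$ is a real function on \<open>{..<D}\<close>, extended by \<open>undefined\<close>.  This is
  exactly the space of the product measure \<open>gauss_dir D\<close> below.
\<close>

definition Rn :: "nat \<Rightarrow> (nat \<Rightarrow> real) set" where
  "Rn D = {..<D} \<rightarrow>\<^sub>E UNIV"

definition edist :: "nat \<Rightarrow> (nat \<Rightarrow> real) \<Rightarrow> (nat \<Rightarrow> real) \<Rightarrow> real" where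
  "edist D x y = L2_set (\<lambda>i. x i - y i) {..<D}"

definition dotp :: "nat \<Rightarrow> (nat \<Rightarrow> real) \<Rightarrow> (nat \<Rightarrow> real) \<Rightarrow> real" where
  "dotp D x y = (\<Sum>i<D. x i * y i)"

definition closed_ball :: "nat \<Rightarrow> (nat \<Rightarrow> real) \<Rightarrow> real \<Rightarrow> (nat \<Rightarrow> real) set" where
  "closed_ball D x r = {y \<in> Rn D. edist D x y \<le> r}"

definition doubling_dim :: "nat \<Rightarrow> (nat \<Rightarrow> real) set \<Rightarrow> nat" where
  "doubling_dim D T = (LEAST d.
     \<forall>x \<in> Rn D. \<forall>r > 0. \<exists>Y \<subseteq> Rn D. finite Y \<and> card Y \<le> 2 ^ d \<and>
       closed_ball D x r \<inter> T \<subseteq> (\<Union>y\<in>Y. closed_ball D y (r / 2)))"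

text \<open>Radius of the smallest enclosing ball; it is \<open>0\<close> for the empty set.\<close>

definition cell_radius :: "nat \<Rightarrow> (nat \<Rightarrow> real) set \<Rightarrow> real" where
  "cell_radius D X = Inf {r. 0 \<le> r \<and> (\<exists>x \<in> Rn D. X \<subseteq> closed_ball D x r)}"

text \<open>
  Median of a nonempty multiset, with the two middle values averaged for even size.  Multisets are
  used so that coinciding projections of distinct points are counted with multiplicity.
\<close>

definition median :: "real multiset \<Rightarrow> real" where
  "median M = (let xs = sorted_list_of_multiset M; n = size M
               in (xs ! ((n - 1) div 2) + xs ! (n div 2)) / 2)"

definition gauss_dir :: "nat \<Rightarrow> (nat \<Rightarrow> real) measure" where
  "gauss_dir D =
     (\<Pi>\<^sub>M i\<in>{..<D}. density lborel (\<lambda>x. ennreal (normal_density 0 (1 / sqrt (real D)) x)))"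

text \<open>
  The randomness of one split is a pair \<open>(v, u)\<close> with \<open>u\<close> uniform on \<open>[-1, 1]\<close> and independent
  of \<open>v\<close>; the offset of the split is \<open>\<delta> = u * (6 * \<Delta> / sqrt D)\<close>, which is uniform on
  \<open>[-6 \<Delta> / sqrt D, 6 \<Delta> / sqrt D]\<close> given everything that happened before the split.
\<close>

definition split_law :: "nat \<Rightarrow> ((nat \<Rightarrow> real) \<times> real) measure" where
  "split_law D = gauss_dir D \<Otimes>\<^sub>M uniform_measure lborel {-1..1}"

text \<open>
  Nodes are addressed by lists of turns, the most recent turn first, \<open>True\<close> meaning left.  The
  proper ancestors of \<open>p\<close> are thus the strict suffixes of \<open>p\<close>.
\<close>

type_synonym node = "bool list"
type_synonym randomness = "node \<Rightarrow> (nat \<Rightarrow> real) \<times> real"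

definition ancestors :: "node \<Rightarrow> node set" where
  "ancestors p = {q. strict_suffix q p}"

definition tree_law :: "nat \<Rightarrow> randomness measure" where
  "tree_law D = (\<Pi>\<^sub>M p\<in>UNIV. split_law D)"

text \<open>
  The arbitrary choice of the point \<open>x\<^sub>0\<close>: given the node \<open>p\<close>, the randomness \<open>h\<close> of the earlier
  splits on the path to \<open>p\<close>, and the data \<open>X\<close> of the cell, it returns a point of \<open>X\<close>.
  Membership in \<open>X\<close> is part of the measurability into \<open>count_space X\<close>.
\<close>

type_synonym selection = "node \<Rightarrow> randomness \<Rightarrow> (nat \<Rightarrow> real) set \<Rightarrow> (nat \<Rightarrow> real)"

definition valid_selection :: "nat \<Rightarrow> (nat \<Rightarrow> real) set \<Rightarrow> selection \<Rightarrow> bool" where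
  "valid_selection D S pick \<longleftrightarrow>
     (\<forall>p X. X \<subseteq> S \<and> X \<noteq> {} \<longrightarrow>
        (\<lambda>h. pick p h X) \<in> (\<Pi>\<^sub>M q\<in>ancestors p. split_law D) \<rightarrow>\<^sub>M count_space X)"

definition split_threshold ::
  "nat \<Rightarrow> (nat \<Rightarrow> real) set \<Rightarrow> (nat \<Rightarrow> real) \<Rightarrow> (nat \<Rightarrow> real) \<Rightarrow> real \<Rightarrow> real" where
  "split_threshold D X x0 v u =
     (let \<Delta> = Max ((\<lambda>y. edist D x0 y) ` X)
      in median (image_mset (\<lambda>z. dotp D z v) (mset_set X)) + u * (6 * \<Delta> / sqrt (real D)))"

text \<open>
  A cell is represented by the data points it contains, so a ball \<open>B\<close> lies in a cell \<open>C\<close> if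
  \<open>S \<inter> B \<subseteq> C\<close>: its data are not separated.  (The full ball of $R^D$ would be cut with a probability
  that grows with \<open>D\<close>.)  \<open>cell_data\<close> is total on addresses; only
  the addresses satisfying \<open>is_node\<close>, all of whose proper ancestors have been split, belong to the
  tree.  A cell is split as long as it contains at least two data points.
\<close>

primrec cell_data ::
  "nat \<Rightarrow> (nat \<Rightarrow> real) set \<Rightarrow> selection \<Rightarrow> randomness \<Rightarrow> node \<Rightarrow> (nat \<Rightarrow> real) set" where
  "cell_data D S pick \<omega> [] = S"
| "cell_data D S pick \<omega> (b # p) =
     (let X = cell_data D S pick \<omega> p;
          x0 = pick p (restrict \<omega> (ancestors p)) X;
          (v, u) = \<omega> p
      in {y \<in> X. dotp D y v < split_threshold D X x0 v u \<longleftrightarrow> b})"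

definition is_node ::
  "nat \<Rightarrow> (nat \<Rightarrow> real) set \<Rightarrow> selection \<Rightarrow> randomness \<Rightarrow> node \<Rightarrow> bool" where
  "is_node D S pick \<omega> p \<longleftrightarrow> (\<forall>q \<in> ancestors p. 2 \<le> card (cell_data D S pick \<omega> q))"

definition rptree_max_cells ::
  "nat \<Rightarrow> (nat \<Rightarrow> real) set \<Rightarrow> selection \<Rightarrow> randomness \<Rightarrow> (nat \<Rightarrow> real) set set" where
  "rptree_max_cells D S pick \<omega> =
     {cell_data D S pick \<omega> p | p. is_node D S pick \<omega> p}"

end

theory Submission
  imports Defs
begin

text \<open>
  Follow the cell that contains the data of the ball, and let \<open>\<Delta>\<close> be its diameter.  A split cuts the
  ball with probability \<open>O(R sqrt d / \<Delta>)\<close>, because chaining over a doubling set bounds the expected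
  width of the projected ball by \<open>O(R sqrt d / sqrt D)\<close>.

  To see that \<open>\<Delta>\<close> shrinks, cover the data by \<open>exp (O(d log d))\<close> balls of radius of order
  \<open>\<Delta> / sqrt d\<close>.  A split separates any two balls of the cover at distance \<open>\<ge> \<Delta> / 4\<close> with at least a
  constant probability, and once no such pair meets the cell its diameter is at most \<open>\<Delta> / 2\<close>.  The
  number \<open>M\<close> of surviving pairs thus decreases by a constant factor in mean, and \<open>1 + ln M\<close>, which is
  \<open>O(d log d)\<close> initially, by a constant.  The sum over the dyadic scales \<open>2 ^ j * T\<close> of these
  logarithms, weighted by \<open>2 ^ (- j)\<close> times a constant multiple of \<open>R sqrt d / T\<close>, is therefore a
  potential that decreases in mean by at least the probability of a cut as long as \<open>\<Delta> > T\<close>.  Hence the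
  probability that the ball is ever cut before \<open>\<Delta> \<le> T\<close> is at most the initial potential
  \<open>O(R d sqrt d log d / T)\<close>.
\<close>

text \<open>The number of splits until the diameter halves is random, and the choice of
  \<open>x0\<close> may depend on the whole history. Taking means of a potential avoids conditioning
  on either: only the effect of one split on a fixed cell with a fixed \<open>x0\<close> is
  estimated, uniformly in both, and these estimates are added up over the tree. The dimension D
  enters through a factor 1 / sqrt D that is common to the projected widths, the spread of the
  projected data and the range of the offset, so it cancels in every ratio. This dictates the radius
  of the covering balls: chaining costs a factor sqrt d, and the projection of such a ball has to be
  small against \<Delta> / sqrt D, the scale of the offset. With 1 + ln M in place of M, the total
  cost is governed by the logarithm of the number of pairs; the jump of size 1 at M = 0 credits the
  loss of the last pair.\<close>

section \<open>The median\<close>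

text \<open>Order statistics become counts, in which form they can be compared with a number of
  outliers and seen to be measurable.\<close>

lemma sorted_nth_le_iff:
  fixes a :: "'a::linorder"
  assumes "sorted xs" "k < length xs"
  shows "xs ! k \<le> a \<longleftrightarrow> k < length (filter (\<lambda>x. x \<le> a) xs)"
  using assms
proof (induction xs arbitrary: k)
  case (Cons x xs)
  show ?case
  proof (cases "x \<le> a")
    case True
    with Cons show ?thesis by (cases k) auto
  next
    case False
    with Cons.prems have "\<forall>y\<in>set (x # xs). \<not> y \<le> a" by auto
    with Cons.prems show ?thesis
      by (metis filter_False less_zeroE list.size(3) nth_mem)
  qed
qed simp

lemma sorted_list_of_multiset_nth_le_iff:
  fixes M :: "real multiset"
  assumes "k < size M"
  shows "sorted_list_of_multiset M ! k \<le> a \<longleftrightarrow> k < size (filter_mset (\<lambda>x. x \<le> a) M)"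
proof -
  have "length (sorted_list_of_multiset M) = size M"
    by (metis mset_sorted_list_of_multiset size_mset)
  moreover have "length (filter (\<lambda>x. x \<le> a) (sorted_list_of_multiset M))
      = size (filter_mset (\<lambda>x. x \<le> a) M)"
    by (metis mset_filter mset_sorted_list_of_multiset size_mset)
  ultimately show ?thesis
    using sorted_nth_le_iff[of "sorted_list_of_multiset M" k a] assms by simp
qed

text \<open>Both middle order statistics lie in the interval, because either of them falling outside
  would put at least half of the elements outside; their average then stays inside.\<close>

lemma median_mem_interval:
  assumes "2 * size (filter_mset (\<lambda>x. \<not> (lo \<le> x \<and> x \<le> hi)) M) < size M"
  shows "lo \<le> median M \<and> median M \<le> hi"
proof -
  define s where "s = sorted_list_of_multiset M"
  have key: "lo \<le> s ! k \<and> s ! k \<le> hi"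
    if k: "(size M - 1) div 2 \<le> k" "k \<le> size M div 2" for k
  proof -
    have kM: "k < size M" using k assms by linarith
    have "size M = size (filter_mset (\<lambda>x. x \<le> hi) M) + size (filter_mset (\<lambda>x. \<not> x \<le> hi) M)"
      by (metis multiset_partition size_union)
    moreover have "size (filter_mset (\<lambda>x. \<not> x \<le> hi) M)
        \<le> size (filter_mset (\<lambda>x. \<not> (lo \<le> x \<and> x \<le> hi)) M)"
      by (intro size_mset_mono mset_subset_eqI) auto
    ultimately have "k < size (filter_mset (\<lambda>x. x \<le> hi) M)"
      using assms k by linarith
    then have "s ! k \<le> hi"
      unfolding s_def using sorted_list_of_multiset_nth_le_iff[OF kM] by simp
    moreover have "lo \<le> s ! k"
    proof (rule ccontr)
      assume neg: "\<not> lo \<le> s ! k"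
      have "k < size (filter_mset (\<lambda>x. x \<le> s ! k) M)"
        using sorted_list_of_multiset_nth_le_iff[OF kM, of "s ! k"] by (simp add: s_def)
      also have "\<dots> \<le> size (filter_mset (\<lambda>x. \<not> (lo \<le> x \<and> x \<le> hi)) M)"
        using neg by (intro size_mset_mono mset_subset_eqI) auto
      finally show False using assms k by linarith
    qed
    ultimately show ?thesis by simp
  qed
  have "lo \<le> s ! ((size M - 1) div 2) \<and> s ! ((size M - 1) div 2) \<le> hi"
    by (rule key) (auto intro!: div_le_mono)
  moreover have "lo \<le> s ! (size M div 2) \<and> s ! (size M div 2) \<le> hi"
    by (rule key) (auto intro!: div_le_mono)
  ultimately show ?thesis
    by (auto simp: median_def Let_def s_def)
qed

lemma size_filter_image_mset_set:
  assumes "finite X"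
  shows "size (filter_mset P (image_mset f (mset_set X))) = card {z\<in>X. P (f z)}"
  using assms by (simp add: filter_mset_image_mset)

lemma borel_measurable_median [measurable (raw)]:
  fixes f :: "'b \<Rightarrow> 'a \<Rightarrow> real"
  assumes f: "\<And>z. z \<in> X \<Longrightarrow> f z \<in> borel_measurable M"
  shows "(\<lambda>v. median (image_mset (\<lambda>z. f z v) (mset_set X))) \<in> borel_measurable M"
proof (cases "finite X \<and> X \<noteq> {}")
  case True
  then have fin: "finite X" and pos: "card X > 0" by (auto simp: card_gt_0_iff)
  have nth: "(\<lambda>v. sorted_list_of_multiset (image_mset (\<lambda>z. f z v) (mset_set X)) ! k)
      \<in> borel_measurable M" if k: "k < card X" for k
  proof (rule borel_measurableI_le)
    fix a
    have "{v \<in> space M. sorted_list_of_multiset (image_mset (\<lambda>z. f z v) (mset_set X)) ! k \<le> a}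
        = {v \<in> space M. k < card {z\<in>X. f z v \<le> a}}"
      using sorted_list_of_multiset_nth_le_iff[of k "image_mset (\<lambda>z. f z _) (mset_set X)" a] k fin
      by (simp add: size_filter_image_mset_set)
    \<comment> \<open>The condition on a cardinality becomes a finite union over the possible sets
      \<open>Y\<close> of finite intersections, so measurability of each \<open>f z\<close>
      suffices.\<close>
    also have "\<dots> = {v \<in> space M. \<exists>Y\<in>{Y. Y \<subseteq> X \<and> k < card Y}. \<forall>z\<in>Y. f z v \<le> a}"
    proof -
      have "k < card {z\<in>X. f z v \<le> a} \<longleftrightarrow> (\<exists>Y\<in>{Y. Y \<subseteq> X \<and> k < card Y}. \<forall>z\<in>Y. f z v \<le> a)" for v
      proof
        assume "\<exists>Y\<in>{Y. Y \<subseteq> X \<and> k < card Y}. \<forall>z\<in>Y. f z v \<le> a"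
        then obtain Y where Y: "Y \<subseteq> X" "k < card Y" "\<forall>z\<in>Y. f z v \<le> a" by auto
        then have "card Y \<le> card {z\<in>X. f z v \<le> a}"
          using fin by (intro card_mono) auto
        with Y show "k < card {z\<in>X. f z v \<le> a}" by simp
      qed (auto intro!: exI[of _ "{z\<in>X. f z v \<le> a}"])
      then show ?thesis by simp
    qed
    also have "\<dots> \<in> sets M"
    proof (intro sets.sets_Collect_finite_Ex sets.sets_Collect_finite_All)
      fix Y z assume "Y \<in> {Y. Y \<subseteq> X \<and> k < card Y}" "z \<in> Y"
      then have [measurable]: "f z \<in> borel_measurable M" using f by auto
      show "{v \<in> space M. f z v \<le> a} \<in> sets M" by measurable
    qed (use fin in \<open>auto intro: finite_subset\<close>)
    finally show "{v \<in> space M. sorted_list_of_multiset (image_mset (\<lambda>z. f z v) (mset_set X)) ! k \<le> a}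
      \<in> sets M" .
  qed
  have "(card X - 1) div 2 < card X" "card X div 2 < card X" using pos by auto
  from this[THEN nth] show ?thesis
    by (auto simp: median_def Let_def)
next
  case False
  then have "mset_set X = {#}" by (cases "finite X") auto
  then show ?thesis by simp
qed

section \<open>Gaussian directions\<close>

lemma prob_space_gauss_dir:
  assumes "1 \<le> D"
  shows "prob_space (gauss_dir D)"
  unfolding gauss_dir_def using assms by (intro prob_space_PiM prob_space_normal_density) auto

lemma sets_gauss_dir [measurable_cong]: "sets (gauss_dir D) = sets (\<Pi>\<^sub>M i\<in>{..<D}. borel)"
  unfolding gauss_dir_def by (intro sets_PiM_cong) auto

lemma space_gauss_dir: "space (gauss_dir D) = Rn D"
  unfolding gauss_dir_def Rn_def by (simp add: space_PiM)

lemma measurable_gauss_dir_component [measurable]: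
  "i < D \<Longrightarrow> (\<lambda>v. v i) \<in> borel_measurable (gauss_dir D)"
  by measurable

lemma borel_measurable_dotp [measurable]: "dotp D w \<in> borel_measurable (gauss_dir D)"
  unfolding dotp_def by measurable

lemma dotp_diff: "dotp D (\<lambda>i. x i - y i) v = dotp D x v - dotp D y v"
  by (simp add: dotp_def left_diff_distrib sum_subtractf)

lemma indep_vars_gauss_dir:
  assumes "1 \<le> D"
  shows "prob_space.indep_vars (gauss_dir D) (\<lambda>i. borel) (\<lambda>i v. v i) {..<D}"
proof -
  let ?N = "density lborel (\<lambda>x. ennreal (normal_density 0 (1 / sqrt (real D)) x))"
  interpret prob_space "gauss_dir D" by (rule prob_space_gauss_dir[OF assms])
  have "distr (gauss_dir D) (\<Pi>\<^sub>M i\<in>{..<D}. borel) (\<lambda>x. \<lambda>i\<in>{..<D}. x i)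
      = distr (gauss_dir D) (gauss_dir D) (\<lambda>x. x)"
    by (rule distr_cong) (auto simp: sets_gauss_dir space_gauss_dir Rn_def PiE_def extensional_def)
  also have "\<dots> = gauss_dir D" by (rule distr_id)
  also have "\<dots> = (\<Pi>\<^sub>M i\<in>{..<D}. distr (gauss_dir D) borel (\<lambda>x. x i))"
  proof -
    have "distr (gauss_dir D) borel (\<lambda>x. x i) = ?N" if i: "i \<in> {..<D}" for i
    proof -
      have "distr (gauss_dir D) borel (\<lambda>x. x i) = distr (gauss_dir D) ?N (\<lambda>x. x i)"
        by (rule distr_cong) auto
      also have "\<dots> = ?N"
        unfolding gauss_dir_def
        using i assms by (intro distr_PiM_component prob_space_normal_density) auto
      finally show ?thesis .
    qed
    then show ?thesis
      unfolding gauss_dir_def by (intro PiM_cong refl) auto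
  qed
  finally show ?thesis
    using assms by (subst indep_vars_iff_distr_eq_PiM') (auto simp: lessThan_empty_iff)
qed

lemma distributed_gauss_dir_component:
  assumes "1 \<le> D" "i < D"
  shows "distributed (gauss_dir D) lborel (\<lambda>v. v i) (normal_density 0 (1 / sqrt (real D)))"
proof -
  let ?N = "density lborel (\<lambda>x. ennreal (normal_density 0 (1 / sqrt (real D)) x))"
  have "distr (gauss_dir D) lborel (\<lambda>x. x i) = distr (gauss_dir D) ?N (\<lambda>x. x i)"
    by (rule distr_cong) auto
  also have "\<dots> = ?N"
    unfolding gauss_dir_def
    using assms by (intro distr_PiM_component prob_space_normal_density) auto
  finally show ?thesis
    using assms by (auto simp: distributed_def)
qed

lemma distributed_dotp:
  assumes D: "1 \<le> D" and pos: "0 < L2_set w {..<D}"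
  shows "distributed (gauss_dir D) lborel (dotp D w)
           (normal_density 0 (L2_set w {..<D} / sqrt (real D)))"
proof -
  interpret prob_space "gauss_dir D" by (rule prob_space_gauss_dir[OF D])
  \<comment> \<open>A vanishing coordinate would contribute a normal law of variance 0, which has no
    density, so these are dropped before the sum of independent normals is formed.\<close>
  define I where "I = {i\<in>{..<D}. w i \<noteq> 0}"
  have I: "finite I" "I \<noteq> {}"
  proof -
    show "I \<noteq> {}"
    proof
      assume "I = {}"
      then have "\<forall>i\<in>{..<D}. w i = 0" by (auto simp: I_def)
      then have "L2_set w {..<D} = 0" by (simp add: L2_set_eq_0_iff)
      with pos show False by simp
    qed
  qed (auto simp: I_def)
  have "indep_vars (\<lambda>i. borel) (\<lambda>i v. v i) I"
    by (rule indep_vars_subset[OF indep_vars_gauss_dir[OF D]]) (auto simp: I_def)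
  then have ind: "indep_vars (\<lambda>i. borel) (\<lambda>i v. w i * v i) I"
    by (rule indep_vars_compose2) auto
  have comp: "distributed (gauss_dir D) lborel (\<lambda>v. w i * v i)
      (normal_density 0 (\<bar>w i\<bar> / sqrt (real D)))" if "i \<in> I" for i
    using normal_density_affine[OF distributed_gauss_dir_component[OF D], of i "w i" 0] that D
    by (simp add: I_def)
  have "distributed (gauss_dir D) lborel (\<lambda>v. \<Sum>i\<in>I. w i * v i)
      (normal_density (\<Sum>i\<in>I. 0) (sqrt (\<Sum>i\<in>I. (\<bar>w i\<bar> / sqrt (real D))\<^sup>2)))"
    using D by (intro sum_indep_normal I ind comp) (auto simp: I_def)
  also have "(\<lambda>v. \<Sum>i\<in>I. w i * v i) = dotp D w"
    unfolding dotp_def I_def by (intro ext sum.mono_neutral_left) auto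
  also have "(\<Sum>i\<in>I. (\<bar>w i\<bar> / sqrt (real D))\<^sup>2) = (\<Sum>i<D. (w i)\<^sup>2) / D"
    unfolding sum_divide_distrib I_def
    by (rule sum.mono_neutral_cong_left) (auto simp: power_divide)
  finally show ?thesis
    by (simp add: L2_set_def real_sqrt_divide)
qed

lemma dotp_eq_0_if_L2_set_eq_0: "L2_set w {..<D} = 0 \<Longrightarrow> dotp D w v = 0"
  by (simp add: L2_set_eq_0_iff dotp_def)

lemma dotp_second_moment:
  assumes D: "1 \<le> D"
  shows "integrable (gauss_dir D) (\<lambda>v. (dotp D w v)\<^sup>2)"
    and "(\<integral>v. (dotp D w v)\<^sup>2 \<partial>gauss_dir D) = (L2_set w {..<D})\<^sup>2 / D"
proof -
  interpret prob_space "gauss_dir D" by (rule prob_space_gauss_dir[OF D])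
  let ?s = "L2_set w {..<D} / sqrt (real D)"
  have "integrable (gauss_dir D) (\<lambda>v. (dotp D w v)\<^sup>2) \<and>
    (\<integral>v. (dotp D w v)\<^sup>2 \<partial>gauss_dir D) = (L2_set w {..<D})\<^sup>2 / D"
  proof (cases "L2_set w {..<D} = 0")
    case True
    then show ?thesis by (simp add: dotp_eq_0_if_L2_set_eq_0)
  next
    case False
    then have pos: "0 < L2_set w {..<D}" by (simp add: less_le)
    then have s: "0 < ?s" using D by simp
    note dist = distributed_dotp[OF D pos]
    have "integrable lborel (\<lambda>x. normal_density 0 ?s x * (x - 0) ^ 2)"
      using s by (rule integrable_normal_moment)
    moreover have "(\<integral>x. normal_density 0 ?s x * (x - 0) ^ (2 * 1) \<partial>lborel)
        = fact (2 * 1) / ((2 / ?s\<^sup>2) ^ 1 * fact 1)"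
      using s by (rule integral_normal_moment_even)
    moreover have "fact (2 * 1) / ((2 / ?s\<^sup>2) ^ 1 * fact 1) = (L2_set w {..<D})\<^sup>2 / D"
      using D by (simp add: power_divide)
    ultimately show ?thesis
      using distributed_integrable[OF dist, of "\<lambda>x. x\<^sup>2"] distributed_integral[OF dist, of "\<lambda>x. x\<^sup>2"]
      by simp
  qed
  then show "integrable (gauss_dir D) (\<lambda>v. (dotp D w v)\<^sup>2)"
    and "(\<integral>v. (dotp D w v)\<^sup>2 \<partial>gauss_dir D) = (L2_set w {..<D})\<^sup>2 / D" by auto
qed

lemma dotp_abs_moment:
  assumes D: "1 \<le> D"
  shows "integrable (gauss_dir D) (\<lambda>v. \<bar>dotp D w v\<bar>)"
    and "(\<integral>v. \<bar>dotp D w v\<bar> \<partial>gauss_dir D) \<le> L2_set w {..<D} / sqrt D"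
proof -
  interpret prob_space "gauss_dir D" by (rule prob_space_gauss_dir[OF D])
  note m2 = dotp_second_moment[OF D, of w]
  have int: "integrable (gauss_dir D) (dotp D w)"
    by (rule square_integrable_imp_integrable) (use m2 in auto)
  show "integrable (gauss_dir D) (\<lambda>v. \<bar>dotp D w v\<bar>)" using int by simp
  show "(\<integral>v. \<bar>dotp D w v\<bar> \<partial>gauss_dir D) \<le> L2_set w {..<D} / sqrt D"
  proof (cases "L2_set w {..<D} = 0")
    case True
    then show ?thesis by (simp add: dotp_eq_0_if_L2_set_eq_0)
  next
    case False
    define s where "s = L2_set w {..<D} / sqrt (real D)"
    have s: "0 < s" using D False by (simp add: less_le s_def)
    have m2': "(\<integral>v. (dotp D w v)\<^sup>2 \<partial>gauss_dir D) = s\<^sup>2"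
      using m2 D by (simp add: s_def power_divide)
    \<comment> \<open>The arithmetic-geometric mean inequality with pivot \<open>s\<close>, the root
      of the second moment, takes the place of Cauchy-Schwarz: the mean of the right-hand side is
      exactly \<open>s\<close>.\<close>
    have "\<bar>t\<bar> \<le> (t\<^sup>2 / s + s) / 2" for t :: real
    proof -
      have "0 \<le> (\<bar>t\<bar> - s)\<^sup>2" by simp
      then have "2 * \<bar>t\<bar> * s \<le> t\<^sup>2 + s * s" by (simp add: power2_eq_square algebra_simps)
      then have "2 * \<bar>t\<bar> \<le> (t\<^sup>2 + s * s) / s" using s by (subst pos_le_divide_eq) auto
      also have "\<dots> = t\<^sup>2 / s + s" using s by (simp only: add_divide_distrib) simp
      finally show ?thesis by simp
    qed
    then have "(\<integral>v. \<bar>dotp D w v\<bar> \<partial>gauss_dir D)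
        \<le> (\<integral>v. ((dotp D w v)\<^sup>2 / s + s) / 2 \<partial>gauss_dir D)"
      using int m2 by (intro integral_mono) auto
    also have "\<dots> = (s\<^sup>2 / s + s) / 2"
      using m2 m2' by (simp add: prob_space)
    also have "\<dots> = s" using s by (simp add: power2_eq_square)
    finally show ?thesis unfolding s_def .
  qed
qed

text \<open>Completing the square: an exponential tilt moves the mean of a Gaussian, and the
  prefactor is its moment generating function.\<close>

lemma normal_density_mult_exp:
  assumes "0 < \<sigma>"
  shows "normal_density 0 \<sigma> x * exp (\<beta> * x)
           = exp (\<beta>\<^sup>2 * \<sigma>\<^sup>2 / 2) * normal_density (\<beta> * \<sigma>\<^sup>2) \<sigma> x"
proof -
  have "- x\<^sup>2 / (2 * \<sigma>\<^sup>2) + \<beta> * x = \<beta>\<^sup>2 * \<sigma>\<^sup>2 / 2 + - (x - \<beta> * \<sigma>\<^sup>2)\<^sup>2 / (2 * \<sigma>\<^sup>2)"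
    using assms by (simp add: power2_eq_square field_simps)
  then have "exp (- x\<^sup>2 / (2 * \<sigma>\<^sup>2)) * exp (\<beta> * x)
      = exp (\<beta>\<^sup>2 * \<sigma>\<^sup>2 / 2) * exp (- (x - \<beta> * \<sigma>\<^sup>2)\<^sup>2 / (2 * \<sigma>\<^sup>2))"
    by (simp only: exp_add[symmetric])
  then show ?thesis
    unfolding normal_density_def by simp
qed

lemma dotp_exp_moment:
  assumes D: "1 \<le> D"
  shows "integrable (gauss_dir D) (\<lambda>v. exp (\<beta> * \<bar>dotp D w v\<bar>))"
    and "(\<integral>v. exp (\<beta> * \<bar>dotp D w v\<bar>) \<partial>gauss_dir D)
           \<le> 2 * exp (\<beta>\<^sup>2 * (L2_set w {..<D})\<^sup>2 / (2 * D))"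
proof -
  interpret prob_space "gauss_dir D" by (rule prob_space_gauss_dir[OF D])
  have mgf: "integrable (gauss_dir D) (\<lambda>v. exp (b * dotp D w v)) \<and>
    (\<integral>v. exp (b * dotp D w v) \<partial>gauss_dir D) = exp (b\<^sup>2 * (L2_set w {..<D})\<^sup>2 / (2 * D))" for b
  proof (cases "L2_set w {..<D} = 0")
    case True
    then show ?thesis by (simp add: dotp_eq_0_if_L2_set_eq_0 prob_space)
  next
    case False
    let ?s = "L2_set w {..<D} / sqrt (real D)"
    from False have pos: "0 < L2_set w {..<D}" by (simp add: less_le)
    then have s: "0 < ?s" using D by simp
    note dist = distributed_dotp[OF D pos]
    have "integrable lborel (\<lambda>x. normal_density 0 ?s x * exp (b * x))"
      using s by (simp only: normal_density_mult_exp) simp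
    moreover have "(\<integral>x. normal_density 0 ?s x * exp (b * x) \<partial>lborel)
        = exp (b\<^sup>2 * (L2_set w {..<D})\<^sup>2 / (2 * D))"
      using s D by (simp only: normal_density_mult_exp) (simp add: power_divide mult.commute)
    ultimately show ?thesis
      using distributed_integrable[OF dist, of "\<lambda>x. exp (b * x)"]
        distributed_integral[OF dist, of "\<lambda>x. exp (b * x)"]
      by simp
  qed
  \<comment> \<open>Either sign of the projection is covered by one of the two exponentials; this is
    where the factor 2 comes from.\<close>
  let ?f = "\<lambda>v. exp (\<beta> * dotp D w v) + exp (- \<beta> * dotp D w v)"
  have le: "exp (\<beta> * \<bar>dotp D w v\<bar>) \<le> ?f v" for v
    by (auto simp: abs_if)
  have int: "integrable (gauss_dir D) ?f"
    using mgf[of \<beta>] mgf[of "- \<beta>"] by auto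
  show int': "integrable (gauss_dir D) (\<lambda>v. exp (\<beta> * \<bar>dotp D w v\<bar>))"
    by (rule Bochner_Integration.integrable_bound[OF int]) (use le in auto)
  have "(\<integral>v. exp (\<beta> * \<bar>dotp D w v\<bar>) \<partial>gauss_dir D) \<le> (\<integral>v. ?f v \<partial>gauss_dir D)"
    using le int int' by (intro integral_mono) auto
  also have "\<dots> = 2 * exp (\<beta>\<^sup>2 * (L2_set w {..<D})\<^sup>2 / (2 * D))"
    using mgf[of \<beta>] mgf[of "- \<beta>"] by simp
  finally show "(\<integral>v. exp (\<beta> * \<bar>dotp D w v\<bar>) \<partial>gauss_dir D) \<le> \<dots>" .
qed

text \<open>With s = |w| / sqrt D, the density of the projection is at most 1 / (2 s) because sqrt
  (2 pi) \<ge> 2, and the interval to be hit has length 2 t.\<close>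

lemma dotp_small_ball:
  assumes D: "1 \<le> D" and pos: "0 < L2_set w {..<D}" and t: "0 \<le> t"
  shows "measure (gauss_dir D) {v \<in> space (gauss_dir D). \<bar>dotp D w v\<bar> < t}
           \<le> t * sqrt D / L2_set w {..<D}"
proof -
  interpret prob_space "gauss_dir D" by (rule prob_space_gauss_dir[OF D])
  let ?s = "L2_set w {..<D} / sqrt (real D)"
  have s: "0 < ?s" using D pos by simp
  note dist = distributed_dotp[OF D pos]
  have bound: "normal_density 0 ?s x \<le> 1 / (2 * ?s)" for x
  proof -
    have "2 \<le> sqrt (2 * pi)"
      using pi_gt3 by (intro real_le_rsqrt) (auto simp: power2_eq_square)
    then have "2 * ?s \<le> sqrt (2 * pi) * ?s" using s by (intro mult_right_mono) auto
    also have "\<dots> = sqrt (2 * pi * ?s\<^sup>2)" using s by (simp add: real_sqrt_mult)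
    finally have "1 / sqrt (2 * pi * ?s\<^sup>2) \<le> 1 / (2 * ?s)"
      using s by (intro frac_le) auto
    moreover have "exp (- (x - 0)\<^sup>2 / (2 * ?s\<^sup>2)) \<le> 1" by simp
    ultimately have "1 / sqrt (2 * pi * ?s\<^sup>2) * exp (- (x - 0)\<^sup>2 / (2 * ?s\<^sup>2)) \<le> 1 / (2 * ?s) * 1"
      using s by (intro mult_mono) auto
    then show ?thesis unfolding normal_density_def by simp
  qed
  have "emeasure (gauss_dir D) {v \<in> space (gauss_dir D). \<bar>dotp D w v\<bar> < t}
      = emeasure (gauss_dir D) (dotp D w -` {-t<..<t} \<inter> space (gauss_dir D))"
    by (rule arg_cong[where f="emeasure _"]) auto
  also have "\<dots> = (\<integral>\<^sup>+x. ennreal (normal_density 0 ?s x) * indicator {-t<..<t} x \<partial>lborel)"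
    by (rule distributed_emeasure[OF dist]) auto
  also have "\<dots> \<le> (\<integral>\<^sup>+x. ennreal (1 / (2 * ?s)) * indicator {-t<..<t} x \<partial>lborel)"
    using bound by (intro nn_integral_mono mult_right_mono ennreal_leI) auto
  also have "\<dots> = ennreal (1 / (2 * ?s)) * ennreal (2 * t)"
    using t by (simp add: nn_integral_cmult)
  also have "\<dots> = ennreal (t * sqrt D / L2_set w {..<D})"
    using s t by (simp add: ennreal_mult[symmetric])
  finally show ?thesis
    using pos t by (simp add: emeasure_eq_measure)
qed

section \<open>Doubling sets\<close>

lemma edist_commute: "edist D x y = edist D y x"
  unfolding edist_def L2_set_def by (simp add: power2_commute)

lemma edist_nonneg [simp]: "0 \<le> edist D x y"
  by (simp add: edist_def)

lemma edist_self [simp]: "edist D x x = 0"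
  by (simp add: edist_def L2_set_def)

lemma edist_triangle: "edist D x z \<le> edist D x y + edist D y z"
proof -
  have "edist D x z = L2_set (\<lambda>i. (x i - y i) + (y i - z i)) {..<D}"
    by (simp add: edist_def)
  also have "\<dots> \<le> edist D x y + edist D y z"
    unfolding edist_def by (rule L2_set_triangle_ineq)
  finally show ?thesis .
qed

lemma edist_eq_0_iff:
  assumes "x \<in> Rn D" "y \<in> Rn D"
  shows "edist D x y = 0 \<longleftrightarrow> x = y"
proof
  assume "edist D x y = 0"
  then have "\<forall>i\<in>{..<D}. x i = y i" by (simp add: edist_def L2_set_eq_0_iff)
  with assms show "x = y" unfolding Rn_def by (intro PiE_ext) auto
qed simp

text \<open>The property minimised in \<open>doubling_dim\<close>, with \<open>d\<close> as a
  parameter.\<close>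

definition doubling :: "nat \<Rightarrow> nat \<Rightarrow> (nat \<Rightarrow> real) set \<Rightarrow> bool" where
  "doubling D d T \<longleftrightarrow> (\<forall>x \<in> Rn D. \<forall>r > 0. \<exists>Y \<subseteq> Rn D. finite Y \<and> card Y \<le> 2 ^ d \<and>
     closed_ball D x r \<inter> T \<subseteq> (\<Union>y\<in>Y. closed_ball D y (r / 2)))"

text \<open>\<open>LEAST\<close> has the property only if some number has it; for finite
  \<open>T\<close> the exponent \<open>card T\<close> does, with balls around the points of
  \<open>T\<close> themselves.\<close>

lemma doubling_doubling_dim:
  assumes "finite T" "T \<subseteq> Rn D"
  shows "doubling D (doubling_dim D T) T"
proof -
  have "doubling D (card T) T"
    unfolding doubling_def
  proof (intro ballI allI impI)
    fix x and r :: real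
    assume "0 < r"
    then have "closed_ball D x r \<inter> T \<subseteq> (\<Union>y\<in>T. closed_ball D y (r / 2))"
      by (auto simp: closed_ball_def)
    moreover have "card T \<le> 2 ^ card T" by (simp add: less_imp_le)
    ultimately show "\<exists>Y\<subseteq>Rn D. finite Y \<and> card Y \<le> 2 ^ card T \<and>
        closed_ball D x r \<inter> T \<subseteq> (\<Union>y\<in>Y. closed_ball D y (r / 2))"
      using assms by blast
  qed
  then show ?thesis
    unfolding doubling_def doubling_dim_def by (rule LeastI)
qed

lemma doubling_cover:
  assumes "doubling D d T" "x \<in> Rn D" "0 < r"
  shows "\<exists>Y\<subseteq>Rn D. finite Y \<and> card Y \<le> 2 ^ (d * k) \<and>
    closed_ball D x r \<inter> T \<subseteq> (\<Union>y\<in>Y. closed_ball D y (r / 2 ^ k))"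
proof (induction k)
  case 0
  then show ?case using assms by (intro exI[of _ "{x}"]) auto
next
  case (Suc k)
  then obtain Y where Y: "Y \<subseteq> Rn D" "finite Y" "card Y \<le> 2 ^ (d * k)"
    "closed_ball D x r \<inter> T \<subseteq> (\<Union>y\<in>Y. closed_ball D y (r / 2 ^ k))" by auto
  have "\<forall>y\<in>Y. \<exists>Z\<subseteq>Rn D. finite Z \<and> card Z \<le> 2 ^ d \<and>
      closed_ball D y (r / 2 ^ k) \<inter> T \<subseteq> (\<Union>z\<in>Z. closed_ball D z (r / 2 ^ k / 2))"
  proof
    fix y assume "y \<in> Y"
    then have "y \<in> Rn D" "0 < r / 2 ^ k" using Y(1) assms(3) by auto
    then show "\<exists>Z\<subseteq>Rn D. finite Z \<and> card Z \<le> 2 ^ d \<and>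
        closed_ball D y (r / 2 ^ k) \<inter> T \<subseteq> (\<Union>z\<in>Z. closed_ball D z (r / 2 ^ k / 2))"
      using assms(1) unfolding doubling_def by blast
  qed
  then obtain Z where Z: "\<And>y. y \<in> Y \<Longrightarrow> Z y \<subseteq> Rn D \<and> finite (Z y) \<and> card (Z y) \<le> 2 ^ d \<and>
      closed_ball D y (r / 2 ^ k) \<inter> T \<subseteq> (\<Union>z\<in>Z y. closed_ball D z (r / 2 ^ k / 2))"
    by metis
  have "card (\<Union>y\<in>Y. Z y) \<le> (\<Sum>y\<in>Y. card (Z y))" by (rule card_UN_le[OF Y(2)])
  also have "\<dots> \<le> card Y * 2 ^ d" using Z sum_bounded_above[of Y "\<lambda>y. card (Z y)" "2 ^ d"] by simp
  also have "\<dots> \<le> 2 ^ (d * k) * 2 ^ d" using Y by simp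
  finally have "card (\<Union>y\<in>Y. Z y) \<le> 2 ^ (d * Suc k)" by (simp add: power_add mult.commute)
  moreover have "closed_ball D x r \<inter> T \<subseteq> (\<Union>z\<in>(\<Union>y\<in>Y. Z y). closed_ball D z (r / 2 ^ Suc k))"
  proof
    fix t assume t: "t \<in> closed_ball D x r \<inter> T"
    then obtain y where "y \<in> Y" "t \<in> closed_ball D y (r / 2 ^ k) \<inter> T" using Y by auto
    with Z[of y] obtain z where "z \<in> Z y" "t \<in> closed_ball D z (r / 2 ^ k / 2)" by blast
    with \<open>y \<in> Y\<close> show "t \<in> (\<Union>z\<in>(\<Union>y\<in>Y. Z y). closed_ball D z (r / 2 ^ Suc k))"
      by (auto simp: mult.commute)
  qed
  ultimately show ?case using Y Z by (intro exI[of _ "\<Union>y\<in>Y. Z y"]) blast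
qed

section \<open>Chaining\<close>

text \<open>The usual bound of order sqrt m * \<rho> / sqrt D on the mean of the maximum of 2^m
  Gaussians. It is stated for an integrable envelope \<open>W\<close>, since in the chaining such
  envelopes are simply added over the levels.\<close>

lemma gaussian_max:
  assumes D: "1 \<le> D" and Q: "finite Q" "card Q \<le> 2 ^ m" and m: "1 \<le> m"
    and \<rho>: "0 < \<rho>" "\<And>w. w \<in> Q \<Longrightarrow> L2_set w {..<D} \<le> \<rho>"
  shows "\<exists>W. integrable (gauss_dir D) W \<and> (\<forall>v. 0 \<le> W v) \<and> (\<forall>v. \<forall>w\<in>Q. \<bar>dotp D w v\<bar> \<le> W v) \<and>
    (\<integral>v. W v \<partial>gauss_dir D) \<le> 2 * sqrt (2 * real m) * \<rho> / sqrt D"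
proof -
  interpret prob_space "gauss_dir D" by (rule prob_space_gauss_dir[OF D])
  \<comment> \<open>This \<open>b\<close> makes each exponential have mean at most 2 e^m. With
    \<open>L\<close> = 2 m the factor e^(-L) then absorbs the at most 2^m \<le> e^m summands and
    leaves the constant 2.\<close>
  define b where "b = sqrt (2 * real m) * sqrt D / \<rho>"
  define L where "L = 2 * real m"
  have b: "0 < b" using m \<rho> D by (simp add: b_def)
  have L: "2 \<le> L" using m by (simp add: L_def)
  \<comment> \<open>Pointwise, \<open>t \<le> (L - 1 + exp (b t - L)) / b\<close>; summing the exponentials over \<open>Q\<close> replaces the
    usual application of Jensen's inequality to the maximum.\<close>
  define W where "W v = (L - 1 + exp (- L) * (\<Sum>w\<in>Q. exp (b * \<bar>dotp D w v\<bar>))) / b" for v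
  have int: "integrable (gauss_dir D) W"
    unfolding W_def using dotp_exp_moment(1)[OF D, of b] by auto
  have nonneg: "0 \<le> W v" for v
    unfolding W_def using b L by (intro divide_nonneg_pos add_nonneg_nonneg mult_nonneg_nonneg sum_nonneg) auto
  have bound: "\<bar>dotp D w v\<bar> \<le> W v" if w: "w \<in> Q" for w v
  proof -
    have "b * \<bar>dotp D w v\<bar> \<le> L - 1 + exp (b * \<bar>dotp D w v\<bar> - L)"
      using exp_ge_add_one_self[of "b * \<bar>dotp D w v\<bar> - L"] by linarith
    also have "exp (b * \<bar>dotp D w v\<bar> - L) = exp (- L) * exp (b * \<bar>dotp D w v\<bar>)"
      by (simp add: exp_add[symmetric])
    also have "\<dots> \<le> exp (- L) * (\<Sum>w\<in>Q. exp (b * \<bar>dotp D w v\<bar>))"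
      using w Q by (intro mult_left_mono member_le_sum) auto
    finally show ?thesis
      unfolding W_def using b by (simp add: pos_le_divide_eq mult.commute)
  qed
  have exp_le: "(\<integral>v. exp (b * \<bar>dotp D w v\<bar>) \<partial>gauss_dir D) \<le> 2 * exp m" if w: "w \<in> Q" for w
  proof -
    have "(\<integral>v. exp (b * \<bar>dotp D w v\<bar>) \<partial>gauss_dir D) \<le> 2 * exp (b\<^sup>2 * (L2_set w {..<D})\<^sup>2 / (2 * D))"
      by (rule dotp_exp_moment(2)[OF D])
    also have "b\<^sup>2 * (L2_set w {..<D})\<^sup>2 / (2 * D) \<le> b\<^sup>2 * \<rho>\<^sup>2 / (2 * D)"
      using \<rho>(2)[OF w] by (intro divide_right_mono mult_left_mono power_mono) auto
    also have "b\<^sup>2 * \<rho>\<^sup>2 / (2 * D) = m"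
      using D \<rho> by (simp add: b_def power_divide power_mult_distrib)
    finally show ?thesis by simp
  qed
  have "(\<integral>v. W v \<partial>gauss_dir D)
      = (L - 1 + exp (- L) * (\<Sum>w\<in>Q. \<integral>v. exp (b * \<bar>dotp D w v\<bar>) \<partial>gauss_dir D)) / b"
    unfolding W_def using dotp_exp_moment(1)[OF D, of b] by (simp add: prob_space)
  also have "\<dots> \<le> (L - 1 + exp (- L) * (2 ^ m * (2 * exp m))) / b"
  proof -
    have "(\<Sum>w\<in>Q. \<integral>v. exp (b * \<bar>dotp D w v\<bar>) \<partial>gauss_dir D) \<le> card Q * (2 * exp m)"
      by (rule sum_bounded_above[OF exp_le])
    also have "\<dots> \<le> 2 ^ m * (2 * exp m)"
      using Q(2) by (intro mult_right_mono) (auto simp: of_nat_le_iff[of "card Q" "2 ^ m", where 'a=real, simplified])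
    finally show ?thesis using b by (intro divide_right_mono add_left_mono mult_left_mono) auto
  qed
  also have "\<dots> \<le> (L - 1 + 2) / b"
  proof -
    have "(2::real) ^ m \<le> exp 1 ^ m"
      using exp_ge_add_one_self[of 1] by (intro power_mono) auto
    also have "\<dots> = exp m" by (simp add: exp_of_nat_mult[symmetric])
    finally have "exp (- L) * (2 ^ m * (2 * exp m)) \<le> exp (- L) * (exp m * (2 * exp m))"
      by (intro mult_left_mono mult_right_mono) auto
    also have "\<dots> = 2" by (simp add: L_def exp_minus field_simps exp_add[symmetric])
    finally show ?thesis using b by (intro divide_right_mono) auto
  qed
  also have "\<dots> \<le> 2 * L / b" using L b by (intro divide_right_mono) auto
  also have "\<dots> = 2 * sqrt (2 * real m) * \<rho> / sqrt D"
  proof -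
    define q where "q = sqrt (2 * real m)"
    have "L = q * q" "0 < q" using m by (simp_all add: L_def q_def)
    then show ?thesis unfolding b_def q_def[symmetric] using D \<rho> by simp
  qed
  finally show ?thesis using int nonneg bound by blast
qed

lemma sum_odd_div_power2: "(\<Sum>i<n. real (2 * i + 1) / 2 ^ i) = 6 - real (4 * n + 6) / 2 ^ n"
proof (induction n)
  case (Suc n)
  have "(\<Sum>i<Suc n. real (2 * i + 1) / 2 ^ i) = 6 - real (4 * n + 6) / 2 ^ n + real (2 * n + 1) / 2 ^ n"
    by (simp only: sum.lessThan_Suc Suc.IH)
  also have "\<dots> = 6 - real (4 * Suc n + 6) / 2 ^ Suc n" by (simp add: field_simps)
  finally show ?case .
qed simp

text \<open>Dudley's chaining over nets at the scales r / 2^k. Level k contributes a term of order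
  sqrt (d (2 k + 1)) * r / 2^k / sqrt D, so the sum is finite whatever the number of points;
  \<open>W\<close> does not depend on the pair \<open>s\<close>, \<open>t\<close>.\<close>

lemma projected_width:
  assumes D: "1 \<le> D" and d: "1 \<le> d" and S: "finite S" "doubling D d S"
    and x: "x \<in> Rn D" and r: "0 < r"
  shows "\<exists>W. integrable (gauss_dir D) W \<and> (\<forall>v. 0 \<le> W v) \<and>
    (\<forall>v. \<forall>s\<in>closed_ball D x r \<inter> S. \<forall>t\<in>closed_ball D x r \<inter> S. \<bar>dotp D s v - dotp D t v\<bar> \<le> W v) \<and>
    (\<integral>v. W v \<partial>gauss_dir D) \<le> 56 * r * sqrt d / sqrt D"
proof -
  interpret prob_space "gauss_dir D" by (rule prob_space_gauss_dir[OF D])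
  let ?T = "closed_ball D x r \<inter> S"
  \<comment> \<open>The chains stop at level \<open>n\<close>. The remaining links are bounded
    crudely by their sum: \<open>n\<close> terms of mean at most r / 2^n / sqrt D, and n / 2^n \<le>
    1.\<close>
  define n where "n = card ?T"
  obtain Y' where Y': "\<And>k. Y' k \<subseteq> Rn D \<and> finite (Y' k) \<and> card (Y' k) \<le> 2 ^ (d * k) \<and>
      ?T \<subseteq> (\<Union>y\<in>Y' k. closed_ball D y (r / 2 ^ k))"
    using doubling_cover[OF S(2) x r] by metis
  \<comment> \<open>The coarsest net is forced to be the centre alone, so that all chains start at
    the same point.\<close>
  define Y where "Y k = (if k = 0 then {x} else Y' k)" for k
  have Y: "finite (Y k)" "card (Y k) \<le> 2 ^ (d * k)" "?T \<subseteq> (\<Union>y\<in>Y k. closed_ball D y (r / 2 ^ k))" for k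
    using Y'[of k] x by (auto simp: Y_def)
  have "\<forall>k. \<forall>s\<in>?T. \<exists>y. y \<in> Y k \<and> edist D y s \<le> r / 2 ^ k"
    using Y(3) by (fastforce simp: closed_ball_def)
  then obtain y where y: "\<And>k s. s \<in> ?T \<Longrightarrow> y k s \<in> Y k \<and> edist D (y k s) s \<le> r / 2 ^ k"
    by metis
  have y0: "y 0 s = x" if "s \<in> ?T" for s using y[OF that, of 0] by (simp add: Y_def)
  \<comment> \<open>The possible links of a chain between two consecutive nets; 3/2 r / 2^k is the
    sum of the two radii r / 2^k and r / 2^(k+1), and d (2 k + 1) = d k + d (k + 1).\<close>
  define Q where "Q k = (\<lambda>(a, b) i. b i - a i) ` {(a, b) \<in> Y k \<times> Y (Suc k). edist D b a \<le> 3 / 2 * r / 2 ^ k}" for k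
  have "\<exists>W. integrable (gauss_dir D) W \<and> (\<forall>v. 0 \<le> W v) \<and> (\<forall>v. \<forall>w\<in>Q k. \<bar>dotp D w v\<bar> \<le> W v) \<and>
    (\<integral>v. W v \<partial>gauss_dir D) \<le> 2 * sqrt (2 * real (d * (2 * k + 1))) * (3 / 2 * r / 2 ^ k) / sqrt D" for k
  proof (rule gaussian_max[OF D])
    have fin: "finite (Y k \<times> Y (Suc k))" using Y by auto
    then show "finite (Q k)" unfolding Q_def by (intro finite_imageI) (auto elim: finite_subset[rotated])
    have "card (Q k) \<le> card (Y k \<times> Y (Suc k))"
      unfolding Q_def using fin by (intro card_image_le[THEN order_trans] card_mono) (auto intro: finite_subset)
    also have "\<dots> \<le> 2 ^ (d * k) * 2 ^ (d * Suc k)"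
      unfolding card_cartesian_product by (intro mult_mono Y) auto
    also have "\<dots> = 2 ^ (d * (2 * k + 1))" by (simp add: power_add[symmetric] algebra_simps)
    finally show "card (Q k) \<le> 2 ^ (d * (2 * k + 1))" .
    show "1 \<le> d * (2 * k + 1)" using d by simp
    show "0 < 3 / 2 * r / 2 ^ k" using r by simp
    show "L2_set w {..<D} \<le> 3 / 2 * r / 2 ^ k" if "w \<in> Q k" for w
      using that by (auto simp: Q_def edist_def)
  qed
  then obtain V where V: "\<And>k. integrable (gauss_dir D) (V k)" "\<And>k v. 0 \<le> V k v"
    "\<And>k v w. w \<in> Q k \<Longrightarrow> \<bar>dotp D w v\<bar> \<le> V k v"
    "\<And>k. (\<integral>v. V k v \<partial>gauss_dir D) \<le> 2 * sqrt (2 * real (d * (2 * k + 1))) * (3 / 2 * r / 2 ^ k) / sqrt D"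
    by metis
  define E where "E v = (\<Sum>s\<in>?T. \<bar>dotp D (\<lambda>i. s i - y n s i) v\<bar>)" for v
  \<comment> \<open>The factor 2 arises because each of the two points is compared with the centre
    \<open>x\<close>.\<close>
  define W where "W v = 2 * ((\<Sum>k<n. V k v) + E v)" for v
  have intE: "integrable (gauss_dir D) E"
    unfolding E_def using dotp_abs_moment(1)[OF D] by auto
  have int: "integrable (gauss_dir D) W"
    unfolding W_def using V(1) intE by auto
  have E_nonneg: "0 \<le> E v" for v unfolding E_def by (simp add: sum_nonneg)
  have nonneg: "0 \<le> W v" for v
    unfolding W_def using V(2) E_nonneg by (simp add: sum_nonneg)
  have half: "\<bar>dotp D s v - dotp D x v\<bar> \<le> W v / 2" if s: "s \<in> ?T" for s v
  proof -
    have step: "\<bar>dotp D (y (Suc k) s) v - dotp D (y k s) v\<bar> \<le> V k v" for k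
    proof -
      have "edist D (y (Suc k) s) (y k s) \<le> edist D (y (Suc k) s) s + edist D s (y k s)"
        by (rule edist_triangle)
      also have "\<dots> \<le> r / 2 ^ Suc k + r / 2 ^ k"
        using y[OF s, of k] y[OF s, of "Suc k"] by (intro add_mono) (auto simp: edist_commute)
      also have "\<dots> = 3 / 2 * r / 2 ^ k" by simp
      finally have "(\<lambda>i. y (Suc k) s i - y k s i) \<in> Q k"
        unfolding Q_def using y[OF s, of k] y[OF s, of "Suc k"]
        by (intro image_eqI[of _ _ "(y k s, y (Suc k) s)"]) auto
      from V(3)[OF this, of v] show ?thesis by (simp add: dotp_diff)
    qed
    have "dotp D s v - dotp D x v
        = (\<Sum>k<n. dotp D (y (Suc k) s) v - dotp D (y k s) v) + (dotp D s v - dotp D (y n s) v)"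
      by (subst sum_lessThan_telescope) (simp add: y0[OF s])
    also have "\<bar>\<dots>\<bar> \<le> (\<Sum>k<n. V k v) + E v"
    proof (rule order_trans[OF abs_triangle_ineq], rule add_mono)
      show "\<bar>\<Sum>k<n. dotp D (y (Suc k) s) v - dotp D (y k s) v\<bar> \<le> (\<Sum>k<n. V k v)"
        by (rule order_trans[OF sum_abs]) (rule sum_mono[OF step])
      have "\<bar>dotp D (\<lambda>i. s i - y n s i) v\<bar> \<le> E v"
        unfolding E_def using s S(1) by (intro member_le_sum[where f="\<lambda>s. \<bar>dotp D (\<lambda>i. s i - y n s i) v\<bar>"]) auto
      then show "\<bar>dotp D s v - dotp D (y n s) v\<bar> \<le> E v" by (simp add: dotp_diff)
    qed
    finally show ?thesis by (simp add: W_def)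
  qed
  have bound: "\<bar>dotp D s v - dotp D t v\<bar> \<le> W v" if "s \<in> ?T" "t \<in> ?T" for s t v
    using half[OF that(1), of v] half[OF that(2), of v] by linarith
  have "(\<integral>v. E v \<partial>gauss_dir D) \<le> r * sqrt d / sqrt D"
  proof -
    have "(\<integral>v. E v \<partial>gauss_dir D) = (\<Sum>s\<in>?T. \<integral>v. \<bar>dotp D (\<lambda>i. s i - y n s i) v\<bar> \<partial>gauss_dir D)"
      unfolding E_def using dotp_abs_moment(1)[OF D] by (intro Bochner_Integration.integral_sum) auto
    also have "\<dots> \<le> real (card ?T) * (r / 2 ^ n / sqrt D)"
    proof (rule sum_bounded_above)
      fix s assume s: "s \<in> ?T"
      have "(\<integral>v. \<bar>dotp D (\<lambda>i. s i - y n s i) v\<bar> \<partial>gauss_dir D) \<le> edist D s (y n s) / sqrt D"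
        unfolding edist_def by (rule dotp_abs_moment(2)[OF D])
      also have "\<dots> \<le> r / 2 ^ n / sqrt D"
        using y[OF s, of n] by (intro divide_right_mono) (auto simp: edist_commute)
      finally show "(\<integral>v. \<bar>dotp D (\<lambda>i. s i - y n s i) v\<bar> \<partial>gauss_dir D) \<le> r / 2 ^ n / sqrt D" .
    qed
    also have "\<dots> = (real n / 2 ^ n) * (r / sqrt D)" by (simp add: n_def)
    also have "\<dots> \<le> 1 * (r / sqrt D)"
    proof (rule mult_right_mono)
      have "real n \<le> 2 ^ n" using of_nat_less_two_power[of n, where 'a=real] by simp
      then show "real n / 2 ^ n \<le> 1" by simp
    qed (use r in auto)
    also have "\<dots> \<le> r * sqrt d / sqrt D"
      using d r by (intro order_trans[OF eq_refl divide_right_mono]) auto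
    finally show ?thesis .
  qed
  moreover have "(\<Sum>k<n. \<integral>v. V k v \<partial>gauss_dir D) \<le> 27 * (r * sqrt d / sqrt D)"
  proof -
    \<comment> \<open>The constant 9/2 is 2 * 3/2 * 3/2: the factor of the Gaussian maximum, the
      length of a link, and a bound on sqrt 2. Replacing sqrt (2 k + 1) by 2 k + 1 gives a series
      with a closed form and sum at most 6, whence 27, and 56 = 2 * (27 + 1) in the end.\<close>
    have "(\<integral>v. V k v \<partial>gauss_dir D) \<le> real (2 * k + 1) / 2 ^ k * (9 / 2 * (r * sqrt d / sqrt D))" for k
    proof -
      have "sqrt (2 * real (d * (2 * k + 1))) = sqrt 2 * sqrt d * sqrt (real (2 * k + 1))"
        by (simp only: real_sqrt_mult of_nat_mult mult.assoc of_nat_numeral)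
      also have "\<dots> \<le> 3 / 2 * sqrt d * real (2 * k + 1)"
      proof (intro mult_mono)
        show "sqrt 2 \<le> 3 / 2" by (rule real_le_lsqrt) (auto simp: power2_eq_square)
        show "sqrt (real (2 * k + 1)) \<le> real (2 * k + 1)"
          by (rule real_le_lsqrt) (auto simp: power2_eq_square algebra_simps)
      qed auto
      finally have "2 * sqrt (2 * real (d * (2 * k + 1))) * (3 / 2 * r / 2 ^ k) / sqrt D
          \<le> 2 * (3 / 2 * sqrt d * real (2 * k + 1)) * (3 / 2 * r / 2 ^ k) / sqrt D"
        using r by (intro divide_right_mono mult_right_mono mult_left_mono) auto
      also have "\<dots> = real (2 * k + 1) / 2 ^ k * (9 / 2 * (r * sqrt d / sqrt D))"
        using D by (simp add: field_simps)
      finally show ?thesis using V(4)[of k] by linarith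
    qed
    then have "(\<Sum>k<n. \<integral>v. V k v \<partial>gauss_dir D)
        \<le> (\<Sum>k<n. real (2 * k + 1) / 2 ^ k * (9 / 2 * (r * sqrt d / sqrt D)))"
      by (rule sum_mono)
    also have "\<dots> = (\<Sum>k<n. real (2 * k + 1) / 2 ^ k) * (9 / 2 * (r * sqrt d / sqrt D))"
      by (simp only: sum_distrib_right)
    also have "\<dots> \<le> 6 * (9 / 2 * (r * sqrt d / sqrt D))"
      unfolding sum_odd_div_power2 using r by (intro mult_right_mono) auto
    finally show ?thesis by simp
  qed
  moreover have "(\<integral>v. W v \<partial>gauss_dir D) = 2 * ((\<Sum>k<n. \<integral>v. V k v \<partial>gauss_dir D) + (\<integral>v. E v \<partial>gauss_dir D))"
    unfolding W_def using V(1) intE by simp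
  ultimately have "(\<integral>v. W v \<partial>gauss_dir D) \<le> 2 * (27 * (r * sqrt d / sqrt D) + r * sqrt d / sqrt D)"
    by (simp only: mult_le_cancel_left_pos zero_less_numeral add_mono)
  also have "\<dots> = 56 * r * sqrt d / sqrt D" by simp
  finally have "(\<integral>v. W v \<partial>gauss_dir D) \<le> 56 * r * sqrt d / sqrt D" .
  with int nonneg bound show ?thesis by blast
qed

section \<open>A single split\<close>

text \<open>The diameter stands in for the radius throughout: it is attained at two data points, so
  a large diameter exhibits a pair that is yet to be separated.\<close>

definition ediam :: "nat \<Rightarrow> (nat \<Rightarrow> real) set \<Rightarrow> real" where
  "ediam D X = Max ((\<lambda>(x, y). edist D x y) ` (X \<times> X))"

lemma edist_le_ediam:
  assumes "finite X" "x \<in> X" "y \<in> X"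
  shows "edist D x y \<le> ediam D X"
  unfolding ediam_def using assms by (intro Max_ge) auto

lemma ediam_attained:
  assumes "finite X" "X \<noteq> {}"
  obtains x y where "x \<in> X" "y \<in> X" "ediam D X = edist D x y"
proof -
  have "ediam D X \<in> (\<lambda>(x, y). edist D x y) ` (X \<times> X)"
    unfolding ediam_def using assms by (intro Max_in) auto
  then show ?thesis using that by auto
qed

text \<open>One step of \<open>cell_data\<close>, isolated so that a split can be analysed for a
  fixed cell and a fixed \<open>x0\<close>, without any history.\<close>

definition child ::
  "nat \<Rightarrow> (nat \<Rightarrow> real) set \<Rightarrow> (nat \<Rightarrow> real) \<Rightarrow> (nat \<Rightarrow> real) \<times> real \<Rightarrow> bool \<Rightarrow> (nat \<Rightarrow> real) set" where
  "child D X x0 s b = {y \<in> X. dotp D y (fst s) < split_threshold D X x0 (fst s) (snd s) \<longleftrightarrow> b}"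

definition proj_median :: "nat \<Rightarrow> (nat \<Rightarrow> real) set \<Rightarrow> (nat \<Rightarrow> real) \<Rightarrow> real" where
  "proj_median D X v = median (image_mset (\<lambda>z. dotp D z v) (mset_set X))"

text \<open>The quantity \<Delta> of \<open>split_threshold\<close>. It depends on the chosen
  \<open>x0\<close>, but for \<open>x0\<close> in \<open>X\<close> it lies between half the diameter
  and the diameter, so the choice costs a factor 2.\<close>

definition eccentricity :: "nat \<Rightarrow> (nat \<Rightarrow> real) set \<Rightarrow> (nat \<Rightarrow> real) \<Rightarrow> real" where
  "eccentricity D X x0 = Max ((\<lambda>y. edist D x0 y) ` X)"

lemma split_threshold_eq:
  "split_threshold D X x0 v u = proj_median D X v + u * (6 * eccentricity D X x0 / sqrt (real D))"
  by (simp add: split_threshold_def proj_median_def eccentricity_def)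

lemma edist_le_eccentricity:
  assumes "finite X" "y \<in> X"
  shows "edist D x0 y \<le> eccentricity D X x0"
  unfolding eccentricity_def using assms by (intro Max_ge) auto

lemma eccentricity_le_ediam:
  assumes "finite X" "x0 \<in> X"
  shows "eccentricity D X x0 \<le> ediam D X"
  unfolding eccentricity_def using assms by (intro Max.boundedI) (auto intro: edist_le_ediam)

lemma ediam_le_eccentricity:
  assumes "finite X" "x0 \<in> X"
  shows "ediam D X \<le> 2 * eccentricity D X x0"
proof -
  from assms obtain x y where xy: "x \<in> X" "y \<in> X" "ediam D X = edist D x y"
    using ediam_attained by blast
  then show ?thesis
    using edist_triangle[of D x y x0] edist_commute[of D x x0]
      edist_le_eccentricity[OF assms(1), of x D x0] edist_le_eccentricity[OF assms(1), of y D x0]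
    by linarith
qed

section \<open>The law of one split and the measurability of its outcome\<close>

lemma prob_space_offset: "prob_space (uniform_measure lborel {-1..1::real})"
  by (rule prob_space_uniform_measure) auto

lemma prob_space_split_law:
  assumes "1 \<le> D"
  shows "prob_space (split_law D)"
proof -
  interpret G: prob_space "gauss_dir D" by (rule prob_space_gauss_dir[OF assms])
  interpret U: prob_space "uniform_measure lborel {-1..1::real}" by (rule prob_space_offset)
  interpret P: pair_prob_space "gauss_dir D" "uniform_measure lborel {-1..1::real}" ..
  show ?thesis unfolding split_law_def by (rule P.prob_space_axioms)
qed

lemma emeasure_split_law:
  assumes "A \<in> sets (split_law D)"
  shows "emeasure (split_law D) A
    = (\<integral>\<^sup>+v. emeasure (uniform_measure lborel {-1..1}) (Pair v -` A) \<partial>gauss_dir D)"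
proof -
  interpret U: prob_space "uniform_measure lborel {-1..1::real}" by (rule prob_space_offset)
  show ?thesis
    using assms unfolding split_law_def by (rule U.emeasure_pair_measure_alt)
qed

lemma sets_split_law_slice: "A \<in> sets (split_law D) \<Longrightarrow> Pair v -` A \<in> sets borel"
  using sets_Pair1[of A "gauss_dir D" "uniform_measure lborel {-1..1::real}" v]
  by (simp add: split_law_def)

lemma emeasure_offset_le:
  assumes "A \<in> sets borel" "A \<subseteq> {l..h}" "l \<le> h"
  shows "emeasure (uniform_measure lborel {-1..1::real}) A \<le> ennreal ((h - l) / 2)"
proof -
  have "emeasure (uniform_measure lborel {-1..1::real}) A = emeasure lborel ({-1..1} \<inter> A) / ennreal 2"
    using assms by (subst emeasure_uniform_measure) auto
  also have "\<dots> \<le> emeasure lborel {l..h} / ennreal 2"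
    using assms by (intro divide_right_mono_ennreal emeasure_mono) auto
  also have "\<dots> = ennreal ((h - l) / 2)"
    using assms by (simp add: divide_ennreal del: ennreal_numeral)
  finally show ?thesis .
qed

lemma emeasure_offset_ge:
  assumes "A \<in> sets borel" "{l<..h} \<subseteq> A" "-1 \<le> l" "l \<le> h" "h \<le> 1"
  shows "ennreal ((h - l) / 2) \<le> emeasure (uniform_measure lborel {-1..1::real}) A"
proof -
  have "ennreal ((h - l) / 2) = emeasure lborel {l<..h} / ennreal 2"
    using assms by (simp add: divide_ennreal del: ennreal_numeral)
  also have "\<dots> \<le> emeasure lborel ({-1..1} \<inter> A) / ennreal 2"
    using assms by (intro divide_right_mono_ennreal emeasure_mono) auto
  also have "\<dots> = emeasure (uniform_measure lborel {-1..1::real}) A"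
    using assms by (subst emeasure_uniform_measure) auto
  finally show ?thesis .
qed

lemma borel_measurable_proj_median [measurable]: "proj_median D X \<in> borel_measurable (gauss_dir D)"
  unfolding proj_median_def by measurable

lemma measurable_fst_split_law [measurable]: "fst \<in> split_law D \<rightarrow>\<^sub>M gauss_dir D"
  unfolding split_law_def by measurable

lemma measurable_snd_split_law [measurable]: "snd \<in> borel_measurable (split_law D)"
proof -
  have "snd \<in> split_law D \<rightarrow>\<^sub>M uniform_measure lborel {-1..1::real}"
    unfolding split_law_def by measurable
  also have "(split_law D \<rightarrow>\<^sub>M uniform_measure lborel {-1..1::real}) = borel_measurable (split_law D)"
    by (rule measurable_cong_sets) auto
  finally show ?thesis .
qed

text \<open>Random cells are treated as maps into the discrete space of subsets of a finite set, so
  that every predicate and every numerical function of a cell is measurable.\<close>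

lemma measurable_finite_set_valued:
  assumes "finite X" "\<And>y. y \<in> X \<Longrightarrow> {s \<in> space M. P y s} \<in> sets M"
  shows "(\<lambda>s. {y \<in> X. P y s}) \<in> M \<rightarrow>\<^sub>M count_space (Pow X)"
proof (subst measurable_count_space_eq2)
  show "(\<lambda>s. {y \<in> X. P y s}) \<in> space M \<rightarrow> Pow X \<and>
      (\<forall>Y\<in>Pow X. (\<lambda>s. {y \<in> X. P y s}) -` {Y} \<inter> space M \<in> sets M)"
  proof (intro conjI ballI)
    fix Y assume "Y \<in> Pow X"
    then have "(\<lambda>s. {y \<in> X. P y s}) -` {Y} \<inter> space M = {s \<in> space M. \<forall>y\<in>X. P y s \<longleftrightarrow> y \<in> Y}"
      by auto
    also have "\<dots> \<in> sets M"
    proof (intro sets.sets_Collect_finite_All assms(1))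
      fix y assume "y \<in> X"
      show "{s \<in> space M. P y s \<longleftrightarrow> y \<in> Y} \<in> sets M"
      proof (cases "y \<in> Y")
        case True
        then show ?thesis using assms(2)[OF \<open>y \<in> X\<close>] by simp
      next
        case False
        then show ?thesis using sets.sets_Collect_neg[OF assms(2)[OF \<open>y \<in> X\<close>]] by simp
      qed
    qed
    finally show "(\<lambda>s. {y \<in> X. P y s}) -` {Y} \<inter> space M \<in> sets M" .
  qed auto
qed (use assms in auto)

lemma measurable_child:
  assumes "finite X"
  shows "(\<lambda>s. child D X x0 s b) \<in> split_law D \<rightarrow>\<^sub>M count_space (Pow X)"
  unfolding child_def split_threshold_eq
  by (rule measurable_finite_set_valued[OF assms]) measurable

lemma pred_child:
  assumes "finite X"
  shows "{s \<in> space (split_law D). P (child D X x0 s b)} \<in> sets (split_law D)"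
  using measurable_sets[OF measurable_child[OF assms], of "{Y \<in> Pow X. P Y}" D x0 b]
    measurable_space[OF measurable_child[OF assms], of _ D x0 b]
  by (auto simp: vimage_def Int_def conj_commute cong: conj_cong elim!: back_subst[of "\<lambda>A. A \<in> sets _"])

text \<open>Given the direction, the set is cut only if the threshold falls within
  \<open>W v\<close> of the projection of one of its points \<open>z\<close>. The offset is uniform
  on [-w, w], so this has probability at most \<open>W v / w\<close> wherever the median lies; it
  remains to average over \<open>v\<close>.\<close>

lemma cut_probability:
  assumes D: "1 \<le> D" and d: "1 \<le> d" and S: "finite S" "doubling D d S"
    and x: "x \<in> Rn D" and R: "0 < R"
    and X: "X \<subseteq> S" "x0 \<in> X" "0 < ediam D X"
    and B: "B \<subseteq> X" "B \<subseteq> closed_ball D x R" "B \<noteq> {}"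
  shows "measure (split_law D) {s \<in> space (split_law D). \<forall>b. \<not> B \<subseteq> child D X x0 s b}
    \<le> 19 * R * sqrt d / ediam D X"
proof -
  have finX: "finite X" using S X finite_subset by blast
  interpret G: prob_space "gauss_dir D" by (rule prob_space_gauss_dir[OF D])
  interpret P: prob_space "split_law D" by (rule prob_space_split_law[OF D])
  obtain z where z: "z \<in> B" using B by auto
  obtain W where W: "integrable (gauss_dir D) W" "\<And>v. 0 \<le> W v"
    "\<And>v s t. s \<in> closed_ball D x R \<inter> S \<Longrightarrow> t \<in> closed_ball D x R \<inter> S \<Longrightarrow> \<bar>dotp D s v - dotp D t v\<bar> \<le> W v"
    "(\<integral>v. W v \<partial>gauss_dir D) \<le> 56 * R * sqrt d / sqrt D"
    using projected_width[OF D d S x R] by blast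
  define w where "w = 6 * eccentricity D X x0 / sqrt (real D)"
  have ecc: "ediam D X \<le> 2 * eccentricity D X x0" by (rule ediam_le_eccentricity[OF finX X(2)])
  have w: "0 < w" using ecc X(3) D by (simp add: w_def)
  let ?A = "{s \<in> space (split_law D). \<forall>b. \<not> B \<subseteq> child D X x0 s b}"
  have "?A = {s \<in> space (split_law D). \<not> B \<subseteq> child D X x0 s True}
      \<inter> {s \<in> space (split_law D). \<not> B \<subseteq> child D X x0 s False}"
    by (auto simp: all_bool_eq)
  also have "\<dots> \<in> sets (split_law D)" by (intro sets.Int pred_child[OF finX])
  finally have A: "?A \<in> sets (split_law D)" .
  have slice: "emeasure (uniform_measure lborel {-1..1}) (Pair v -` ?A) \<le> ennreal (W v / w)" for v
  proof -
    let ?c = "dotp D z v - proj_median D X v"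
    have "Pair v -` ?A \<subseteq> {(?c - W v) / w..(?c + W v) / w}"
    proof
      fix u assume "u \<in> Pair v -` ?A"
      then have cut: "\<not> B \<subseteq> child D X x0 (v, u) True" "\<not> B \<subseteq> child D X x0 (v, u) False" by auto
      let ?t = "proj_median D X v + u * w"
      have "\<exists>y\<in>B. \<not> dotp D y v < ?t"
        using cut(1) B(1) by (auto simp: child_def split_threshold_eq w_def)
      then obtain y where y: "y \<in> B" "?t \<le> dotp D y v" by (auto simp: not_less)
      have "\<exists>y\<in>B. dotp D y v < ?t"
        using cut(2) B(1) by (auto simp: child_def split_threshold_eq w_def)
      then obtain y' where y': "y' \<in> B" "dotp D y' v < ?t" by auto
      have "\<bar>dotp D y v - dotp D z v\<bar> \<le> W v" "\<bar>dotp D y' v - dotp D z v\<bar> \<le> W v"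
        using B X y y' z by (auto intro!: W(3))
      then have "?c - W v \<le> u * w" "u * w \<le> ?c + W v" using y y' by linarith+
      then show "u \<in> {(?c - W v) / w..(?c + W v) / w}"
        using w by (auto simp: pos_divide_le_eq pos_le_divide_eq)
    qed
    moreover have "Pair v -` ?A \<in> sets borel" by (rule sets_split_law_slice[OF A])
    ultimately have "emeasure (uniform_measure lborel {-1..1}) (Pair v -` ?A)
        \<le> ennreal (((?c + W v) / w - (?c - W v) / w) / 2)"
      using w W(2)[of v] by (intro emeasure_offset_le divide_right_mono) auto
    also have "((?c + W v) / w - (?c - W v) / w) / 2 = W v / w"
      by (simp add: diff_divide_distrib[symmetric])
    finally show ?thesis .
  qed
  have "emeasure (split_law D) ?A \<le> (\<integral>\<^sup>+v. ennreal (W v / w) \<partial>gauss_dir D)"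
    unfolding emeasure_split_law[OF A] by (intro nn_integral_mono slice)
  also have "\<dots> = ennreal ((\<integral>v. W v \<partial>gauss_dir D) / w)"
    using W w by (subst nn_integral_eq_integral) auto
  finally have "measure (split_law D) ?A \<le> (\<integral>v. W v \<partial>gauss_dir D) / w"
    using W w by (simp add: P.emeasure_eq_measure integral_nonneg)
  \<comment> \<open>Since the eccentricity is at least half the diameter, w \<ge> 3
    \<open>ediam D X\<close> / sqrt D. Here sqrt D cancels, and 19 is 56 / 3 rounded up.\<close>
  also have "\<dots> \<le> (56 * R * sqrt d / sqrt D) / (3 * ediam D X / sqrt D)"
  proof (rule frac_le)
    show "3 * ediam D X / sqrt D \<le> w"
      unfolding w_def using ecc by (intro divide_right_mono) auto
  qed (use W X D R in auto)
  also have "\<dots> = 56 / 3 * (R * sqrt d / ediam D X)"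
    using D by simp
  also have "\<dots> \<le> 19 * (R * sqrt d / ediam D X)"
    using R X by (intro mult_right_mono) auto
  finally show ?thesis by simp
qed

text \<open>Chebyshev's inequality at three standard deviations, with r / sqrt D as an upper bound
  on the standard deviation.\<close>

lemma dotp_tail:
  assumes D: "1 \<le> D" and r: "L2_set w {..<D} \<le> r" "0 < r"
  shows "measure (gauss_dir D) {v \<in> space (gauss_dir D). \<bar>dotp D w v\<bar> > 3 * r / sqrt D} \<le> 1 / 9"
proof -
  interpret prob_space "gauss_dir D" by (rule prob_space_gauss_dir[OF D])
  let ?c = "(3 * r / sqrt D)\<^sup>2"
  have c: "0 < ?c" "?c = 9 * r\<^sup>2 / D" using D r by (auto simp: power_divide power_mult_distrib)
  have "measure (gauss_dir D) {v \<in> space (gauss_dir D). \<bar>dotp D w v\<bar> > 3 * r / sqrt D}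
      \<le> measure (gauss_dir D) {v \<in> space (gauss_dir D). ?c \<le> (dotp D w v)\<^sup>2}"
  proof (rule finite_measure_mono)
    have "?c \<le> t\<^sup>2" if "\<bar>t\<bar> > 3 * r / sqrt D" for t :: real
      using that r by (subst power2_abs[of t, symmetric]) (intro power_mono, auto)
    then show "{v \<in> space (gauss_dir D). \<bar>dotp D w v\<bar> > 3 * r / sqrt D}
        \<subseteq> {v \<in> space (gauss_dir D). ?c \<le> (dotp D w v)\<^sup>2}" by auto
  qed measurable
  also have "\<dots> \<le> (\<integral>v. (dotp D w v)\<^sup>2 \<partial>gauss_dir D) / ?c"
    by (rule integral_Markov_inequality_measure[OF dotp_second_moment(1)[OF D], where A="{}"])
       (use c in auto)
  also have "\<dots> \<le> (r\<^sup>2 / D) / ?c"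
    unfolding dotp_second_moment(2)[OF D] using r c
    by (intro divide_right_mono power_mono) auto
  also have "\<dots> = 1 / 9" unfolding c(2) using r D by simp
  finally show ?thesis .
qed

text \<open>Each point projects far from \<open>x0\<close> with probability at most 1/9, and the
  median can be far only if at least half of the points are. Markov's inequality for the number
  \<open>N\<close> of far points gives (1/9) / (1/2).\<close>

lemma proj_median_concentration:
  assumes D: "1 \<le> D" and X: "finite X" "x0 \<in> X" and pos: "0 < eccentricity D X x0"
  shows "measure (gauss_dir D) {v \<in> space (gauss_dir D).
    \<bar>proj_median D X v - dotp D x0 v\<bar> > 3 * eccentricity D X x0 / sqrt D} \<le> 2 / 9"
proof -
  interpret prob_space "gauss_dir D" by (rule prob_space_gauss_dir[OF D])
  let ?r = "3 * eccentricity D X x0 / sqrt D"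
  define far where "far z = {v \<in> space (gauss_dir D). \<bar>dotp D (\<lambda>i. z i - x0 i) v\<bar> > ?r}" for z
  have far [measurable]: "far z \<in> sets (gauss_dir D)" for z unfolding far_def by measurable
  define N where "N v = (\<Sum>z\<in>X. indicator (far z) v :: real)" for v
  have cardX: "0 < real (card X)" using X by (auto simp: card_gt_0_iff)
  have N: "integrable (gauss_dir D) N" "\<And>v. 0 \<le> N v"
    unfolding N_def by (auto simp: sum_nonneg less_top[symmetric])
  have "(\<integral>v. N v \<partial>gauss_dir D) = (\<Sum>z\<in>X. measure (gauss_dir D) (far z))"
    unfolding N_def by (subst Bochner_Integration.integral_sum) (auto simp: less_top[symmetric])
  also have "\<dots> \<le> real (card X) * (1 / 9)"
  proof (rule sum_bounded_above)
    fix z assume "z \<in> X"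
    then have "L2_set (\<lambda>i. z i - x0 i) {..<D} \<le> eccentricity D X x0"
      using edist_le_eccentricity[OF X(1), of z D x0] by (simp add: edist_commute[of D x0] edist_def[symmetric])
    from dotp_tail[OF D this pos] show "measure (gauss_dir D) (far z) \<le> 1 / 9" by (simp add: far_def)
  qed
  finally have EN: "(\<integral>v. N v \<partial>gauss_dir D) \<le> real (card X) / 9" by simp
  have "measure (gauss_dir D) {v \<in> space (gauss_dir D). \<bar>proj_median D X v - dotp D x0 v\<bar> > ?r}
      \<le> measure (gauss_dir D) {v \<in> space (gauss_dir D). real (card X) / 2 \<le> N v}"
  proof (rule finite_measure_mono)
    show "{v \<in> space (gauss_dir D). real (card X) / 2 \<le> N v} \<in> sets (gauss_dir D)"
      unfolding N_def by measurable
    show "{v \<in> space (gauss_dir D). \<bar>proj_median D X v - dotp D x0 v\<bar> > ?r}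
        \<subseteq> {v \<in> space (gauss_dir D). real (card X) / 2 \<le> N v}"
    proof safe
      fix v assume v: "v \<in> space (gauss_dir D)" "\<bar>proj_median D X v - dotp D x0 v\<bar> > ?r"
      let ?P = "\<lambda>t. \<not> (dotp D x0 v - ?r \<le> t \<and> t \<le> dotp D x0 v + ?r)"
      let ?M = "image_mset (\<lambda>z. dotp D z v) (mset_set X)"
      have "\<not> 2 * size (filter_mset ?P ?M) < size ?M"
        using median_mem_interval[of "dotp D x0 v - ?r" "dotp D x0 v + ?r" ?M] v(2)
        unfolding proj_median_def by linarith
      then have "card X \<le> 2 * card {z\<in>X. ?P (dotp D z v)}"
        by (simp add: size_filter_image_mset_set[OF X(1)])
      also have "{z\<in>X. ?P (dotp D z v)} = {z\<in>X. v \<in> far z}"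
        using v(1) by (auto simp: far_def dotp_diff abs_if)
      finally have "real (card X) \<le> 2 * real (card {z\<in>X. v \<in> far z})" by linarith
      also have "real (card {z\<in>X. v \<in> far z}) = N v"
        unfolding N_def using X(1) by (simp add: indicator_def sum.If_cases Int_def)
      finally show "real (card X) / 2 \<le> N v" by simp
    qed
  qed
  also have "\<dots> \<le> (\<integral>v. N v \<partial>gauss_dir D) / (real (card X) / 2)"
    by (rule integral_Markov_inequality_measure[OF N(1), where A="{}"]) (use N cardX in auto)
  also have "\<dots> \<le> (real (card X) / 9) / (real (card X) / 2)"
    using EN cardX by (intro divide_right_mono) auto
  also have "\<dots> = 2 / 9" using cardX by simp
  finally show ?thesis .
qed

text \<open>Markov's inequality; the factor 2^18 is generous enough for 56 * 144 / 2^18 \<le> 1/18.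
  The level \<Delta> / (144 sqrt D) is a quarter of the gap that is required between the projections
  of two far points.\<close>

lemma width_tail:
  assumes D: "1 \<le> D" and d: "1 \<le> d" and S: "finite S" "doubling D d S"
    and y: "y \<in> Rn D" and e: "0 < e" "e * 2 ^ 18 * sqrt d \<le> \<Delta>"
  obtains W where "W \<in> borel_measurable (gauss_dir D)"
    "\<And>v s t. s \<in> closed_ball D y e \<inter> S \<Longrightarrow> t \<in> closed_ball D y e \<inter> S \<Longrightarrow> \<bar>dotp D s v - dotp D t v\<bar> \<le> W v"
    "measure (gauss_dir D) {v \<in> space (gauss_dir D). W v \<ge> \<Delta> / (144 * sqrt D)} \<le> 1 / 18"
proof -
  interpret prob_space "gauss_dir D" by (rule prob_space_gauss_dir[OF D])
  obtain W where W: "integrable (gauss_dir D) W" "\<And>v. 0 \<le> W v"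
    "\<And>v s t. s \<in> closed_ball D y e \<inter> S \<Longrightarrow> t \<in> closed_ball D y e \<inter> S \<Longrightarrow> \<bar>dotp D s v - dotp D t v\<bar> \<le> W v"
    "(\<integral>v. W v \<partial>gauss_dir D) \<le> 56 * e * sqrt d / sqrt D"
    using projected_width[OF D d S y e(1)] by blast
  have \<Delta>: "0 < \<Delta>" using e d by (intro less_le_trans[OF _ e(2)]) auto
  have "measure (gauss_dir D) {v \<in> space (gauss_dir D). W v \<ge> \<Delta> / (144 * sqrt D)}
      \<le> (\<integral>v. W v \<partial>gauss_dir D) / (\<Delta> / (144 * sqrt D))"
    by (rule integral_Markov_inequality_measure[OF W(1), where A="{}"]) (use W \<Delta> D in auto)
  also have "\<dots> \<le> (56 * (\<Delta> / 2 ^ 18) / sqrt D) / (\<Delta> / (144 * sqrt D))"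
  proof (rule divide_right_mono[OF order_trans[OF W(4)]])
    have "e * sqrt d \<le> \<Delta> / 2 ^ 18" using e(2) by (simp add: field_simps)
    then show "56 * e * sqrt d / sqrt D \<le> 56 * (\<Delta> / 2 ^ 18) / sqrt D"
      by (intro divide_right_mono) auto
  qed (use \<Delta> in auto)
  also have "\<dots> \<le> 1 / 18" using \<Delta> D by simp
  finally show ?thesis using that[OF borel_measurable_integrable[OF W(1)] W(3)] by blast
qed

text \<open>For a constant proportion of directions the two small sets project to short intervals
  with a gap between them, and that gap lies within the range of the random threshold. The offset
  then falls into the gap with constant probability.\<close>

lemma separation_probability:
  assumes D: "1 \<le> D" and d: "1 \<le> d" and S: "finite S" "doubling D d S"
    and X: "X \<subseteq> S" "x0 \<in> X" "ediam D X \<le> \<Delta>"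
    and y: "y1 \<in> Rn D" "y2 \<in> Rn D" and e: "0 < e" "e * 2 ^ 18 * sqrt d \<le> \<Delta>"
    and U: "U1 \<subseteq> X \<inter> closed_ball D y1 e" "U2 \<subseteq> X \<inter> closed_ball D y2 e"
    and ab: "a \<in> U1" "b \<in> U2" "\<Delta> / 4 \<le> edist D a b"
  shows "1 / 2592 \<le> measure (split_law D) {s \<in> space (split_law D).
    \<forall>c. child D X x0 s c \<inter> U1 = {} \<or> child D X x0 s c \<inter> U2 = {}}"
proof -
  have finX: "finite X" using S X finite_subset by blast
  interpret G: prob_space "gauss_dir D" by (rule prob_space_gauss_dir[OF D])
  interpret P: prob_space "split_law D" by (rule prob_space_split_law[OF D])
  let ?E = "eccentricity D X x0" and ?q = "sqrt (real D)"
  have q: "0 < ?q" using D by simp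
  have \<Delta>: "0 < \<Delta>" using e d by (intro less_le_trans[OF _ e(2)]) auto
  have aX: "a \<in> X" and bX: "b \<in> X" using U ab by auto
  have "0 < ediam D X" using edist_le_ediam[OF finX aX bX, of D] ab(3) \<Delta> by linarith
  then have E: "0 < ?E" using ediam_le_eccentricity[OF finX X(2), of D] by linarith
  have E\<Delta>: "?E \<le> \<Delta>" using eccentricity_le_ediam[OF finX X(2), of D] X(3) by linarith
  obtain W1 where W1: "W1 \<in> borel_measurable (gauss_dir D)"
    "\<And>v s t. s \<in> closed_ball D y1 e \<inter> S \<Longrightarrow> t \<in> closed_ball D y1 e \<inter> S \<Longrightarrow> \<bar>dotp D s v - dotp D t v\<bar> \<le> W1 v"
    "measure (gauss_dir D) {v \<in> space (gauss_dir D). W1 v \<ge> \<Delta> / (144 * ?q)} \<le> 1 / 18"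
    using width_tail[OF D d S y(1) e] by blast
  obtain W2 where W2: "W2 \<in> borel_measurable (gauss_dir D)"
    "\<And>v s t. s \<in> closed_ball D y2 e \<inter> S \<Longrightarrow> t \<in> closed_ball D y2 e \<inter> S \<Longrightarrow> \<bar>dotp D s v - dotp D t v\<bar> \<le> W2 v"
    "measure (gauss_dir D) {v \<in> space (gauss_dir D). W2 v \<ge> \<Delta> / (144 * ?q)} \<le> 1 / 18"
    using width_tail[OF D d S y(2) e] by blast
  note [measurable] = W1(1) W2(1)
  define K1 where "K1 = {v \<in> space (gauss_dir D). W1 v \<ge> \<Delta> / (144 * ?q)}"
  define K2 where "K2 = {v \<in> space (gauss_dir D). W2 v \<ge> \<Delta> / (144 * ?q)}"
  define K3 where "K3 = {v \<in> space (gauss_dir D). \<bar>dotp D (\<lambda>i. a i - x0 i) v\<bar> > 3 * ?E / ?q}"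
  define K4 where "K4 = {v \<in> space (gauss_dir D). \<bar>dotp D (\<lambda>i. b i - x0 i) v\<bar> > 3 * ?E / ?q}"
  define K5 where "K5 = {v \<in> space (gauss_dir D). \<bar>proj_median D X v - dotp D x0 v\<bar> > 3 * ?E / ?q}"
  define K6 where "K6 = {v \<in> space (gauss_dir D). \<bar>dotp D (\<lambda>i. a i - b i) v\<bar> < \<Delta> / (36 * ?q)}"
  have [measurable]: "K1 \<in> sets (gauss_dir D)" "K2 \<in> sets (gauss_dir D)" "K3 \<in> sets (gauss_dir D)"
    "K4 \<in> sets (gauss_dir D)" "K5 \<in> sets (gauss_dir D)" "K6 \<in> sets (gauss_dir D)"
    unfolding K1_def K2_def K3_def K4_def K5_def K6_def by measurable
  \<comment> \<open>The exceptional directions: one of the small sets is wide, \<open>a\<close>,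
    \<open>b\<close> or the median is far from \<open>x0\<close>, or \<open>a\<close> and
    \<open>b\<close> project too close together. Their budgets are 1/18 + 1/18 + 1/9 + 1/9 + 2/9 +
    1/9 = 2/3.\<close>
  define K where "K = K1 \<union> (K2 \<union> (K3 \<union> (K4 \<union> (K5 \<union> K6))))"
  have K [measurable]: "K \<in> sets (gauss_dir D)" unfolding K_def by measurable
  have K3: "measure (gauss_dir D) K3 \<le> 1 / 9"
    unfolding K3_def
    using edist_le_eccentricity[OF finX aX, of D x0] E
    by (intro dotp_tail[OF D]) (auto simp: edist_commute[of D x0] edist_def[symmetric])
  have K4: "measure (gauss_dir D) K4 \<le> 1 / 9"
    unfolding K4_def
    using edist_le_eccentricity[OF finX bX, of D x0] E
    by (intro dotp_tail[OF D]) (auto simp: edist_commute[of D x0] edist_def[symmetric])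
  have K5: "measure (gauss_dir D) K5 \<le> 2 / 9"
    unfolding K5_def by (rule proj_median_concentration[OF D finX X(2) E])
  have K6: "measure (gauss_dir D) K6 \<le> 1 / 9"
  proof -
    have "measure (gauss_dir D) K6 \<le> \<Delta> / (36 * ?q) * ?q / edist D a b"
      unfolding K6_def edist_def using ab(3) \<Delta> q
      by (intro dotp_small_ball[OF D]) (auto simp: edist_def)
    also have "\<dots> = \<Delta> / 36 / edist D a b" using q by simp
    also have "\<dots> \<le> \<Delta> / 36 / (\<Delta> / 4)"
      using ab(3) \<Delta> by (intro divide_left_mono) (auto intro!: mult_pos_pos)
    also have "\<dots> = 1 / 9" using \<Delta> by simp
    finally show ?thesis .
  qed
  have "measure (gauss_dir D) K \<le> 2 / 3"
    unfolding K_def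
    using W1(3)[folded K1_def] W2(3)[folded K2_def] K3 K4 K5 K6
      measure_Un_le[of K1 "gauss_dir D" "K2 \<union> (K3 \<union> (K4 \<union> (K5 \<union> K6)))"]
      measure_Un_le[of K2 "gauss_dir D" "K3 \<union> (K4 \<union> (K5 \<union> K6))"]
      measure_Un_le[of K3 "gauss_dir D" "K4 \<union> (K5 \<union> K6)"]
      measure_Un_le[of K4 "gauss_dir D" "K5 \<union> K6"]
      measure_Un_le[of K5 "gauss_dir D" "K6"]
    by (simp add: sets.Un)
  then have good: "1 / 3 \<le> measure (gauss_dir D) (space (gauss_dir D) - K)"
    by (simp add: G.prob_compl)
  let ?A = "{s \<in> space (split_law D). \<forall>c. child D X x0 s c \<inter> U1 = {} \<or> child D X x0 s c \<inter> U2 = {}}"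
  have "?A = {s \<in> space (split_law D). child D X x0 s True \<inter> U1 = {} \<or> child D X x0 s True \<inter> U2 = {}}
      \<inter> {s \<in> space (split_law D). child D X x0 s False \<inter> U1 = {} \<or> child D X x0 s False \<inter> U2 = {}}"
    by (auto simp: all_bool_eq)
  also have "\<dots> \<in> sets (split_law D)" by (intro sets.Int pred_child[OF finX])
  finally have A: "?A \<in> sets (split_law D)" .
  define w where "w = 6 * ?E / ?q"
  have w: "0 < w" using E q by (simp add: w_def)
  have slice: "ennreal (1 / 864) \<le> emeasure (uniform_measure lborel {-1..1}) (Pair v -` ?A)"
    if v: "v \<in> space (gauss_dir D) - K" for v
  proof -
    define m where "m = proj_median D X v"
    define g where "g = \<Delta> / (144 * ?q)"
    have g: "0 < g" "\<Delta> / (36 * ?q) = 4 * g" using \<Delta> q by (auto simp: g_def)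
    \<comment> \<open>The deviation allowed by \<open>K3\<close>, \<open>K4\<close> and
      \<open>K5\<close> is half of \<open>w\<close>. Hence \<open>a\<close> and \<open>b\<close>
      project to within \<open>w\<close> of the median, where the threshold can reach them; this is
      what the factor 6 in the splitting rule provides.\<close>
    have close: "\<bar>dotp D a v - dotp D x0 v\<bar> \<le> w / 2" "\<bar>dotp D b v - dotp D x0 v\<bar> \<le> w / 2"
      "\<bar>m - dotp D x0 v\<bar> \<le> w / 2" and apart: "4 * g \<le> \<bar>dotp D a v - dotp D b v\<bar>"
      using v unfolding K_def K3_def K4_def K5_def K6_def g(2) w_def m_def
      by (auto simp: dotp_diff not_less)
    have near: "m - w \<le> dotp D a v" "m - w \<le> dotp D b v" "dotp D a v \<le> m + w" "dotp D b v \<le> m + w"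
      using close by linarith+
    have width: "\<bar>dotp D y v - dotp D a v\<bar> < g" if "y \<in> U1" for y
    proof -
      have "\<bar>dotp D y v - dotp D a v\<bar> \<le> W1 v" using that U ab X by (intro W1(2)) auto
      also have "\<dots> < g" using v unfolding K_def K1_def g_def by auto
      finally show ?thesis .
    qed
    have width': "\<bar>dotp D y v - dotp D b v\<bar> < g" if "y \<in> U2" for y
    proof -
      have "\<bar>dotp D y v - dotp D b v\<bar> \<le> W2 v" using that U ab X by (intro W2(2)) auto
      also have "\<dots> < g" using v unfolding K_def K2_def g_def by auto
      finally show ?thesis .
    qed
    \<comment> \<open>The values of \<open>u\<close> that put the threshold into the gap. Of the
      distance of at least 4 \<open>g\<close> between \<open>a\<close> and \<open>b\<close>, each
      small set takes up at most \<open>g\<close>, so at least 2 \<open>g\<close> is left.\<close>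
    define lo where "lo = (min (dotp D a v) (dotp D b v) + g - m) / w"
    define hi where "hi = (max (dotp D a v) (dotp D b v) - g - m) / w"
    have wlo: "lo * w = min (dotp D a v) (dotp D b v) + g - m"
      and whi: "hi * w = max (dotp D a v) (dotp D b v) - g - m" using w by (auto simp: lo_def hi_def)
    have len: "2 * g / w \<le> hi - lo"
      unfolding lo_def hi_def diff_divide_distrib[symmetric]
      using apart w by (intro divide_right_mono) (auto simp: min_def max_def)
    have "Pair v -` ?A \<in> sets borel" by (rule sets_split_law_slice[OF A])
    moreover have "{lo<..hi} \<subseteq> Pair v -` ?A"
    proof
      fix u assume "u \<in> {lo<..hi}"
      then have "lo * w < u * w" "u * w \<le> hi * w" using w by auto
      then have u: "min (dotp D a v) (dotp D b v) + g < m + u * w"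
        "m + u * w \<le> max (dotp D a v) (dotp D b v) - g" unfolding wlo whi by linarith+
      have "child D X x0 (v, u) c \<inter> U1 = {} \<or> child D X x0 (v, u) c \<inter> U2 = {}" for c
      proof (cases "dotp D a v \<le> dotp D b v")
        case True
        then have "dotp D y v < m + u * w" if "y \<in> U1" for y
          using width[OF that] u by (auto simp: min_def)
        moreover have "\<not> dotp D y v < m + u * w" if "y \<in> U2" for y
          using width'[OF that] u True by (auto simp: max_def)
        ultimately show ?thesis
          unfolding child_def split_threshold_eq w_def m_def by (cases c) auto
      next
        case False
        then have "\<not> dotp D y v < m + u * w" if "y \<in> U1" for y
          using width[OF that] u by (auto simp: max_def)
        moreover have "dotp D y v < m + u * w" if "y \<in> U2" for y
          using width'[OF that] u False by (auto simp: min_def)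
        ultimately show ?thesis
          unfolding child_def split_threshold_eq w_def m_def by (cases c) auto
      qed
      moreover have "(v, u) \<in> space (split_law D)"
        using v by (auto simp: split_law_def space_pair_measure)
      ultimately show "u \<in> Pair v -` ?A" by auto
    qed
    moreover have "-1 \<le> lo"
      unfolding lo_def using w near g(1) by (subst pos_le_divide_eq) (auto simp: min_def)
    moreover have "hi \<le> 1"
      unfolding hi_def using w near g(1) by (subst pos_divide_le_eq) (auto simp: max_def)
    moreover have "lo \<le> hi"
    proof -
      have "0 \<le> 2 * g / w" using g(1) w by simp
      with len show ?thesis by linarith
    qed
    ultimately have "ennreal ((hi - lo) / 2) \<le> emeasure (uniform_measure lborel {-1..1}) (Pair v -` ?A)"
      by (intro emeasure_offset_ge) auto
    \<comment> \<open>The ratio \<open>g / w\<close> is \<Delta> / (864 E) with 864 = 144 * 6, and E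
      \<le> \<Delta>. Together with the mass of at least 1/3 of the good directions this yields
      1/2592.\<close>
    moreover have "1 / 864 \<le> (hi - lo) / 2"
    proof -
      have "1 / 864 \<le> g / w"
        unfolding g_def w_def using E E\<Delta> q by (simp add: field_simps)
      moreover have "2 * (g / w) \<le> hi - lo" using len by simp
      ultimately show ?thesis by (simp only: le_divide_eq_numeral1)
    qed
    ultimately show ?thesis using ennreal_leI order_trans by blast
  qed
  have "ennreal (1 / 2592) = ennreal (1 / 864) * ennreal (1 / 3)"
    by (simp add: ennreal_mult[symmetric])
  also have "\<dots> \<le> ennreal (1 / 864) * emeasure (gauss_dir D) (space (gauss_dir D) - K)"
    using good by (intro mult_left_mono) (auto simp: G.emeasure_eq_measure)
  also have "\<dots> = (\<integral>\<^sup>+v. ennreal (1 / 864) * indicator (space (gauss_dir D) - K) v \<partial>gauss_dir D)"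
    by (subst nn_integral_cmult_indicator) auto
  also have "\<dots> \<le> (\<integral>\<^sup>+v. emeasure (uniform_measure lborel {-1..1}) (Pair v -` ?A) \<partial>gauss_dir D)"
    using slice by (intro nn_integral_mono) (auto split: split_indicator)
  also have "\<dots> = emeasure (split_law D) ?A" by (rule emeasure_split_law[OF A, symmetric])
  finally show ?thesis by (simp add: P.emeasure_eq_measure)
qed

section \<open>The random tree\<close>

lemma ancestors_Nil [simp]: "ancestors [] = {}"
  by (simp add: ancestors_def)

lemma ancestors_Cons [simp]: "ancestors (b # p) = insert p (ancestors p)"
  by (auto simp: ancestors_def strict_suffix_def suffix_Cons dest: suffix_length_le)

lemma not_in_ancestors_self [simp]: "p \<notin> ancestors p"
  by (simp add: ancestors_def)

lemma cell_data_Cons: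
  "cell_data D S pick \<omega> (b # p) =
    child D (cell_data D S pick \<omega> p)
      (pick p (restrict \<omega> (ancestors p)) (cell_data D S pick \<omega> p)) (\<omega> p) b"
  by (simp add: child_def Let_def split_beta)

declare cell_data.simps(2) [simp del]

lemma child_subset: "child D X x0 s b \<subseteq> X"
  by (auto simp: child_def)

lemma child_True_Int_child_False: "child D X x0 s True \<inter> child D X x0 s False = {}"
  by (auto simp: child_def)

lemma cell_data_subset: "cell_data D S pick \<omega> p \<subseteq> S"
  by (induction p) (use child_subset in \<open>fastforce simp: cell_data_Cons\<close>)+

lemma finite_cell_data: "finite S \<Longrightarrow> finite (cell_data D S pick \<omega> p)"
  by (rule finite_subset[OF cell_data_subset])

lemma restrict_fun_upd_other: "q \<notin> A \<Longrightarrow> restrict (f(q := s)) A = restrict f A"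
  by (auto simp: restrict_def fun_eq_iff)

text \<open>A cell is determined by the splits at its proper ancestors, also through
  \<open>pick\<close>, which sees only the restricted randomness. In particular it does not depend
  on the split at \<open>p\<close> itself.\<close>

lemma cell_data_upd:
  "q \<notin> ancestors p \<Longrightarrow> cell_data D S pick ((\<omega>)(q := s)) p = cell_data D S pick \<omega> p"
proof (induction p)
  case (Cons b p)
  then have q: "q \<notin> ancestors p" "((\<omega>)(q := s)) p = \<omega> p" by auto
  show ?case
    by (simp only: cell_data_Cons Cons.IH[OF q(1)] restrict_fun_upd_other[OF q(1)] q(2))
qed simp

lemma prob_space_tree_law: "1 \<le> D \<Longrightarrow> prob_space (tree_law D)"
  unfolding tree_law_def by (intro prob_space_PiM prob_space_split_law)

lemma measurable_tree_law_component [measurable]: "(\<lambda>\<omega>. \<omega> p) \<in> tree_law D \<rightarrow>\<^sub>M split_law D"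
  unfolding tree_law_def by measurable

lemma measurable_pick:
  assumes "valid_selection D S pick" "X \<subseteq> S" "X \<noteq> {}"
  shows "(\<lambda>\<omega>. pick p (restrict \<omega> (ancestors p)) X) \<in> tree_law D \<rightarrow>\<^sub>M count_space X"
proof -
  have "(\<lambda>\<omega>. restrict \<omega> (ancestors p)) \<in> tree_law D \<rightarrow>\<^sub>M (\<Pi>\<^sub>M q\<in>ancestors p. split_law D)"
    unfolding tree_law_def by (rule measurable_restrict_subset) simp
  moreover have "(\<lambda>h. pick p h X) \<in> (\<Pi>\<^sub>M q\<in>ancestors p. split_law D) \<rightarrow>\<^sub>M count_space X"
    using assms unfolding valid_selection_def by blast
  ultimately show ?thesis by (rule measurable_compose)
qed

lemma measurable_cell_data:
  assumes S: "finite S" and pick: "valid_selection D S pick"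
  shows "(\<lambda>\<omega>. cell_data D S pick \<omega> p) \<in> tree_law D \<rightarrow>\<^sub>M count_space (Pow S)"
proof (induction p)
  case (Cons b p)
  show ?case
    unfolding cell_data_Cons
  \<comment> \<open>The parent cell and the chosen point take finitely many values, so they can be
    fixed one after the other; what remains is a function of the single split
    \<open>\<omega> p\<close>.\<close>
  proof (rule measurable_compose_countable'[OF _ Cons.IH])
    show "countable (Pow S)" using S by (simp add: countable_finite)
    fix X assume X: "X \<in> Pow S"
    show "(\<lambda>\<omega>. child D X (pick p (restrict \<omega> (ancestors p)) X) (\<omega> p) b)
        \<in> tree_law D \<rightarrow>\<^sub>M count_space (Pow S)"
    \<comment> \<open>Validity constrains \<open>pick\<close> on nonempty data only; an empty cell
      has empty children whatever is picked.\<close>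
    proof (cases "X = {}")
      case True
      then show ?thesis by (simp add: child_def)
    next
      case False
      show ?thesis
      proof (rule measurable_compose_countable'[OF _ measurable_pick[OF pick]])
        show "countable X" using S X by (auto intro: countable_finite finite_subset)
        fix x0
        have finX: "finite X" using S X by (auto intro: finite_subset)
        have "(\<lambda>s. child D X x0 s b) \<in> split_law D \<rightarrow>\<^sub>M count_space (Pow S)"
          by (rule measurable_compose[OF measurable_child[OF finX], of "\<lambda>Y. Y"])
            (use X in auto)
        then show "(\<lambda>\<omega>. child D X x0 (\<omega> p) b) \<in> tree_law D \<rightarrow>\<^sub>M count_space (Pow S)"
          by (rule measurable_compose[OF measurable_tree_law_component])
      qed (use X False in auto)
    qed
  qed
qed simp

lemma sets_Collect_cell_data:
  assumes "finite S" "valid_selection D S pick"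
  shows "{\<omega> \<in> space (tree_law D). P (cell_data D S pick \<omega> p)} \<in> sets (tree_law D)"
proof -
  have "(\<lambda>\<omega>. P (cell_data D S pick \<omega> p)) \<in> tree_law D \<rightarrow>\<^sub>M count_space UNIV"
    by (rule measurable_compose[OF measurable_cell_data[OF assms]]) simp
  then show ?thesis by (simp add: pred_def)
qed

lemma is_node_Cons:
  "is_node D S pick \<omega> (b # p) \<longleftrightarrow> 2 \<le> card (cell_data D S pick \<omega> p) \<and> is_node D S pick \<omega> p"
  by (auto simp: is_node_def)

lemma sets_Collect_is_node:
  assumes "finite S" "valid_selection D S pick"
  shows "{\<omega> \<in> space (tree_law D). is_node D S pick \<omega> p} \<in> sets (tree_law D)"
proof (induction p)
  case (Cons b p)
  then show ?case
    unfolding is_node_Cons by (intro sets.sets_Collect_conj sets_Collect_cell_data[OF assms])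
qed (simp add: is_node_def)

lemma sets_Collect_rptree_max_cells:
  assumes "finite S" "valid_selection D S pick"
  shows "{\<omega> \<in> space (tree_law D). \<exists>C\<in>rptree_max_cells D S pick \<omega>. P C} \<in> sets (tree_law D)"
proof -
  have "{\<omega> \<in> space (tree_law D). \<exists>C\<in>rptree_max_cells D S pick \<omega>. P C}
      = {\<omega> \<in> space (tree_law D). \<exists>p. P (cell_data D S pick \<omega> p) \<and> is_node D S pick \<omega> p}"
    by (auto simp: rptree_max_cells_def)
  also have "\<dots> \<in> sets (tree_law D)"
    by (intro sets.sets_Collect_countable_Ex sets.sets_Collect_conj sets_Collect_cell_data
        sets_Collect_is_node assms)
  finally show ?thesis .
qed

text \<open>Overwriting the split at \<open>p\<close> by a fresh sample preserves the law of the
  tree. This expresses the independence of that split from everything else and takes the place of a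
  conditional expectation given the past.\<close>

lemma nn_integral_tree_law_resample:
  assumes D: "1 \<le> D" and f: "f \<in> borel_measurable (tree_law D)"
  shows "(\<integral>\<^sup>+\<omega>. f \<omega> \<partial>tree_law D) = (\<integral>\<^sup>+\<omega>. (\<integral>\<^sup>+s. f ((\<omega>)(p := s)) \<partial>split_law D) \<partial>tree_law D)"
proof -
  interpret A: prob_space "split_law D" by (rule prob_space_split_law[OF D])
  interpret B: prob_space "tree_law D" by (rule prob_space_tree_law[OF D])
  interpret P: pair_prob_space "split_law D" "tree_law D" ..
  have upd: "(\<lambda>(s, \<omega>). (\<omega>)(p := s)) \<in> split_law D \<Otimes>\<^sub>M tree_law D \<rightarrow>\<^sub>M tree_law D"
    unfolding tree_law_def split_beta
    by (rule measurable_PiM_single') (auto simp: fun_upd_def space_pair_measure space_PiM)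
  have "distr (split_law D \<Otimes>\<^sub>M tree_law D) (tree_law D) (\<lambda>(s, \<omega>). (\<omega>)(p := s)) = tree_law D"
    using distr_pair_PiM_eq_PiM[of UNIV "\<lambda>_. split_law D" p] prob_space_split_law[OF D]
    by (simp add: tree_law_def)
  then have "(\<integral>\<^sup>+\<omega>. f \<omega> \<partial>tree_law D)
      = (\<integral>\<^sup>+\<omega>. f \<omega> \<partial>distr (split_law D \<Otimes>\<^sub>M tree_law D) (tree_law D) (\<lambda>(s, \<omega>). (\<omega>)(p := s)))"
    by simp
  also have "\<dots> = (\<integral>\<^sup>+x. f ((\<lambda>(s, \<omega>). (\<omega>)(p := s)) x) \<partial>(split_law D \<Otimes>\<^sub>M tree_law D))"
    using f by (intro nn_integral_distr[OF upd]) simp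
  also have "\<dots> = (\<integral>\<^sup>+\<omega>. (\<integral>\<^sup>+s. f ((\<omega>)(p := s)) \<partial>split_law D) \<partial>tree_law D)"
    using P.nn_integral_snd[of "\<lambda>x. f ((\<lambda>(s, \<omega>). (\<omega>)(p := s)) x)"] measurable_compose[OF upd f]
    by simp
  finally show ?thesis .
qed

section \<open>From a potential for one split to the failure probability\<close>

lemma ediam_mono:
  assumes "finite Y" "X \<subseteq> Y" "X \<noteq> {}"
  shows "ediam D X \<le> ediam D Y"
  unfolding ediam_def using assms by (intro Max_mono) auto

text \<open>Ensures that a cell which is still too large is really split, so that its children
  belong to the tree.\<close>

lemma two_le_card_if_ediam_pos:
  assumes "finite X" "X \<noteq> {}" "0 < ediam D X"
  shows "2 \<le> card X"
proof -
  obtain x y where "x \<in> X" "y \<in> X" "ediam D X = edist D x y"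
    using ediam_attained[OF assms(1,2)] .
  moreover from this have "x \<noteq> y" using assms(3) by auto
  ultimately have "{x, y} \<subseteq> X" "x \<noteq> y" by auto
  then show ?thesis using card_mono[OF assms(1), of "{x, y}"] by simp
qed

lemma sum_lists_Suc:
  fixes h :: "bool list \<Rightarrow> 'a::comm_monoid_add"
  shows "(\<Sum>p\<in>{p. length p = Suc n}. h p) = (\<Sum>p\<in>{p. length p = n}. h (True # p) + h (False # p))"
proof -
  have fin: "finite {p :: bool list. length p = n}"
    using finite_lists_length_eq[of "UNIV :: bool set" n] by simp
  have "{p. length p = Suc n} = (#) True ` {p. length p = n} \<union> (#) False ` {p. length p = n}"
    by (auto simp: length_Suc_conv image_iff)
  then have "(\<Sum>p\<in>{p. length p = Suc n}. h p)
      = (\<Sum>p\<in>(#) True ` {p. length p = n}. h p) + (\<Sum>p\<in>(#) False ` {p. length p = n}. h p)"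
    using fin by (simp only:) (rule sum.union_disjoint, auto)
  also have "\<dots> = (\<Sum>p\<in>{p. length p = n}. h (True # p) + h (False # p))"
    by (simp add: sum.reindex inj_on_def sum.distrib)
  finally show ?thesis .
qed

text \<open>The potential after a split, where a cut is charged 1, the full loss in probability. For
  nonempty \<open>B\<close> the order of the two tests is immaterial, as the children are
  disjoint.\<close>

definition next_potential ::
  "nat \<Rightarrow> (nat \<Rightarrow> real) set \<Rightarrow> ((nat \<Rightarrow> real) set \<Rightarrow> ennreal) \<Rightarrow> (nat \<Rightarrow> real) set \<Rightarrow>
    (nat \<Rightarrow> real) \<Rightarrow> (nat \<Rightarrow> real) \<times> real \<Rightarrow> ennreal" where
  "next_potential D B \<Phi> X x0 s =
    (if B \<subseteq> child D X x0 s True then \<Phi> (child D X x0 s True)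
     else if B \<subseteq> child D X x0 s False then \<Phi> (child D X x0 s False) else 1)"

lemma borel_measurable_children:
  assumes "finite X"
  shows "(\<lambda>s. f (child D X x0 s True) (child D X x0 s False)) \<in> borel_measurable (split_law D)"
proof -
  have "(\<lambda>s. (child D X x0 s True, child D X x0 s False))
      \<in> split_law D \<rightarrow>\<^sub>M count_space (Pow X) \<Otimes>\<^sub>M count_space (Pow X)"
    using measurable_child[OF assms] by measurable
  also have "count_space (Pow X) \<Otimes>\<^sub>M count_space (Pow X) = count_space (Pow X \<times> Pow X)"
    using assms by (simp add: pair_measure_countable countable_finite)
  finally have *: "(\<lambda>s. (child D X x0 s True, child D X x0 s False))
      \<in> split_law D \<rightarrow>\<^sub>M count_space (Pow X \<times> Pow X)" .
  have "(\<lambda>s. (\<lambda>(Y, Z). f Y Z) (child D X x0 s True, child D X x0 s False))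
      \<in> borel_measurable (split_law D)"
    by (rule measurable_compose[OF *]) simp
  then show ?thesis by simp
qed

lemma measurable_next_potential:
  assumes "finite X"
  shows "next_potential D B \<Phi> X x0 \<in> borel_measurable (split_law D)"
  unfolding next_potential_def
  by (rule borel_measurable_children[OF assms, of "\<lambda>Y Z. if B \<subseteq> Y then \<Phi> Y else if B \<subseteq> Z then \<Phi> Z else 1"])

text \<open>The alive cells at depth \<open>n\<close> are those that contain \<open>B\<close> and still have diameter above \<open>T\<close>; since \<open>B\<close> is
  nonempty there is at most one of them.  The potential pays for the cuts of \<open>B\<close>, and its drift
  \<open>\<eta>\<close> makes the expected number of alive cells finite.\<close>

lemma failure_probability_le_potential:
  fixes \<Phi> :: "(nat \<Rightarrow> real) set \<Rightarrow> ennreal" and \<eta> :: real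
  assumes D: "1 \<le> D" and S: "finite S" and pick: "valid_selection D S pick"
    and B: "B \<subseteq> S" "B \<noteq> {}" and T: "0 \<le> T" and \<eta>: "0 < \<eta>"
    and step: "\<And>X x0. B \<subseteq> X \<Longrightarrow> X \<subseteq> S \<Longrightarrow> T < ediam D X \<Longrightarrow> x0 \<in> X \<Longrightarrow>
      ennreal \<eta> + (\<integral>\<^sup>+s. next_potential D B \<Phi> X x0 s \<partial>split_law D) \<le> \<Phi> X"
  shows "emeasure (tree_law D) {\<omega> \<in> space (tree_law D).
      \<not> (\<exists>C\<in>rptree_max_cells D S pick \<omega>. B \<subseteq> C \<and> ediam D C \<le> T)} \<le> \<Phi> S"
proof -
  interpret prob_space "tree_law D" by (rule prob_space_tree_law[OF D])
  interpret A: prob_space "split_law D" by (rule prob_space_split_law[OF D])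
  let ?c = "\<lambda>\<omega> p. cell_data D S pick \<omega> p"
  define alive where "alive X \<longleftrightarrow> B \<subseteq> X \<and> T < ediam D X" for X
  define Ev where "Ev p = {\<omega> \<in> space (tree_law D). alive (?c \<omega> p)}" for p
  define Cut where "Cut p = {\<omega> \<in> space (tree_law D). alive (?c \<omega> p) \<and>
    (\<not> B \<subseteq> ?c \<omega> (True # p) \<and> \<not> B \<subseteq> ?c \<omega> (False # p))}" for p
  define u where "u p = (\<integral>\<^sup>+\<omega>. indicator (Ev p) \<omega> * \<Phi> (?c \<omega> p) \<partial>tree_law D)" for p
  define x where "x \<omega> p = pick p (restrict \<omega> (ancestors p)) (?c \<omega> p)" for \<omega> p
  have Ev [measurable]: "Ev p \<in> sets (tree_law D)" for p
    unfolding Ev_def by (rule sets_Collect_cell_data[OF S pick])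
  have Cut [measurable]: "Cut p \<in> sets (tree_law D)" for p
    unfolding Cut_def by (intro sets.sets_Collect_conj sets_Collect_cell_data[OF S pick])
  have cell_fun [measurable]: "(\<lambda>\<omega>. h (?c \<omega> p)) \<in> borel_measurable (tree_law D)"
    for h :: "(nat \<Rightarrow> real) set \<Rightarrow> ennreal" and p
    by (rule measurable_compose[OF measurable_cell_data[OF S pick]]) simp
  have alive_pred: "alive (?c \<omega> p)" if "alive (?c \<omega> (b # p))" for \<omega> b p
  proof -
    have sub: "?c \<omega> (b # p) \<subseteq> ?c \<omega> p" by (simp add: cell_data_Cons child_subset)
    moreover have "finite (?c \<omega> p)" by (rule finite_cell_data[OF S])
    moreover have "B \<subseteq> ?c \<omega> (b # p)" using that by (simp add: alive_def)
    ultimately have "ediam D (?c \<omega> (b # p)) \<le> ediam D (?c \<omega> p)" "B \<subseteq> ?c \<omega> p"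
      using B(2) by (auto intro!: ediam_mono)
    with that show ?thesis by (simp add: alive_def)
  qed
  have x: "x \<omega> p \<in> ?c \<omega> p" if "\<omega> \<in> space (tree_law D)" "?c \<omega> p \<noteq> {}" for \<omega> p
    using measurable_space[OF measurable_pick[OF pick cell_data_subset that(2), of p]] that(1)
    by (simp add: x_def)
  \<comment> \<open>The supermartingale inequality at one node, already integrated: the mean
    potential \<open>u p\<close> pays for being alive, for a cut at \<open>p\<close>, and for the
    potential handed on to the children.\<close>
  have drift: "ennreal \<eta> * emeasure (tree_law D) (Ev p) + emeasure (tree_law D) (Cut p)
      + (u (True # p) + u (False # p)) \<le> u p" for p
  proof -
    \<comment> \<open>\<open>F\<close> dominates all the payments pointwise. Resampling the split at
      \<open>p\<close> leaves the cell and the chosen point unchanged, so the inner integral of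
      \<open>F\<close> is the left-hand side of \<open>step\<close> for a fixed cell.\<close>
    define F where "F \<omega> = indicator (Ev p) \<omega> * (ennreal \<eta> +
      (if B \<subseteq> ?c \<omega> (True # p) then \<Phi> (?c \<omega> (True # p))
       else if B \<subseteq> ?c \<omega> (False # p) then \<Phi> (?c \<omega> (False # p)) else 1))" for \<omega>
    have mF: "F \<in> borel_measurable (tree_law D)"
    proof -
      have "{\<omega> \<in> space (tree_law D). B \<subseteq> ?c \<omega> q} \<in> sets (tree_law D)" for q
        by (rule sets_Collect_cell_data[OF S pick])
      then show ?thesis unfolding F_def by measurable
    qed
    have "ennreal \<eta> * emeasure (tree_law D) (Ev p) + emeasure (tree_law D) (Cut p)
        + (u (True # p) + u (False # p))
        = (\<integral>\<^sup>+\<omega>. ennreal \<eta> * indicator (Ev p) \<omega> + indicator (Cut p) \<omega>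
            + (indicator (Ev (True # p)) \<omega> * \<Phi> (?c \<omega> (True # p))
               + indicator (Ev (False # p)) \<omega> * \<Phi> (?c \<omega> (False # p))) \<partial>tree_law D)"
      unfolding u_def by (simp add: nn_integral_add nn_integral_cmult)
    also have "\<dots> \<le> (\<integral>\<^sup>+\<omega>. F \<omega> \<partial>tree_law D)"
    proof (rule nn_integral_mono)
      fix \<omega> assume \<omega>: "\<omega> \<in> space (tree_law D)"
      have "\<not> (B \<subseteq> ?c \<omega> (True # p) \<and> B \<subseteq> ?c \<omega> (False # p))"
        using child_True_Int_child_False B(2) unfolding cell_data_Cons by blast
      moreover have sub: "\<omega> \<in> Ev (b # p) \<Longrightarrow> \<omega> \<in> Ev p \<and> B \<subseteq> ?c \<omega> (b # p)" for b
        using alive_pred[of \<omega> b p] by (simp add: Ev_def) (simp add: alive_def)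
      moreover note sub[of True] sub[of False]
      moreover have "\<omega> \<in> Cut p \<Longrightarrow> \<omega> \<in> Ev p \<and> \<not> B \<subseteq> ?c \<omega> (True # p) \<and> \<not> B \<subseteq> ?c \<omega> (False # p)"
        by (simp add: Ev_def Cut_def)
      ultimately show "ennreal \<eta> * indicator (Ev p) \<omega> + indicator (Cut p) \<omega>
            + (indicator (Ev (True # p)) \<omega> * \<Phi> (?c \<omega> (True # p))
               + indicator (Ev (False # p)) \<omega> * \<Phi> (?c \<omega> (False # p))) \<le> F \<omega>"
        by (cases "\<omega> \<in> Ev (True # p)"; cases "\<omega> \<in> Ev (False # p)"; cases "\<omega> \<in> Cut p"; cases "\<omega> \<in> Ev p")
          (simp_all add: F_def)
    qed
    also have "\<dots> = (\<integral>\<^sup>+\<omega>. (\<integral>\<^sup>+s. F ((\<omega>)(p := s)) \<partial>split_law D) \<partial>tree_law D)"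
      by (rule nn_integral_tree_law_resample[OF D mF])
    also have "\<dots> \<le> u p"
      unfolding u_def
    proof (rule nn_integral_mono)
      fix \<omega> assume \<omega>: "\<omega> \<in> space (tree_law D)"
      have F: "F ((\<omega>)(p := s)) = indicator (Ev p) \<omega> *
          (ennreal \<eta> + next_potential D B \<Phi> (?c \<omega> p) (x \<omega> p) s)" if "s \<in> space (split_law D)" for s
      proof -
        have "?c ((\<omega>)(p := s)) (b # p) = child D (?c \<omega> p) (x \<omega> p) s b" for b
          by (simp add: cell_data_Cons cell_data_upd x_def restrict_fun_upd_other del: fun_upd_apply)
            (simp add: fun_upd_apply)
        moreover have "(\<omega>)(p := s) \<in> space (tree_law D)"
          using \<omega> that by (auto simp: tree_law_def space_PiM)
        then have "(\<omega>)(p := s) \<in> Ev p \<longleftrightarrow> \<omega> \<in> Ev p"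
          using \<omega> by (simp add: Ev_def cell_data_upd)
        ultimately show ?thesis
          by (simp add: F_def next_potential_def indicator_def)
      qed
      show "(\<integral>\<^sup>+s. F ((\<omega>)(p := s)) \<partial>split_law D) \<le> indicator (Ev p) \<omega> * \<Phi> (?c \<omega> p)"
      proof (cases "\<omega> \<in> Ev p")
        case False
        then show ?thesis using F by (simp cong: nn_integral_cong)
      next
        case True
        then have al: "B \<subseteq> ?c \<omega> p" "T < ediam D (?c \<omega> p)" by (auto simp: Ev_def alive_def)
        have fin: "finite (?c \<omega> p)" by (rule finite_cell_data[OF S])
        have "(\<integral>\<^sup>+s. F ((\<omega>)(p := s)) \<partial>split_law D)
            = (\<integral>\<^sup>+s. ennreal \<eta> + next_potential D B \<Phi> (?c \<omega> p) (x \<omega> p) s \<partial>split_law D)"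
          using F True by (intro nn_integral_cong) simp
        also have "\<dots> = ennreal \<eta> + (\<integral>\<^sup>+s. next_potential D B \<Phi> (?c \<omega> p) (x \<omega> p) s \<partial>split_law D)"
          using measurable_next_potential[OF fin]
          by (simp add: nn_integral_add A.emeasure_space_1)
        also have "\<dots> \<le> \<Phi> (?c \<omega> p)"
          using al B(2) by (intro step cell_data_subset x \<omega>) auto
        finally show ?thesis using True by simp
      qed
    qed
    finally show ?thesis .
  qed
  let ?L = "\<lambda>n. {p :: node. length p = n}"
  have finL: "finite (?L n)" for n
    using finite_lists_length_eq[of "UNIV :: bool set" n] by simp
  define a where "a n = (\<Sum>p\<in>?L n. emeasure (tree_law D) (Ev p))" for n
  define k where "k n = (\<Sum>p\<in>?L n. emeasure (tree_law D) (Cut p))" for n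
  \<comment> \<open>Summed over all nodes of one depth, the potentials of the children are those of
    the next depth, so the inequality telescopes.\<close>
  have level: "ennreal \<eta> * a n + k n + (\<Sum>p\<in>?L (Suc n). u p) \<le> (\<Sum>p\<in>?L n. u p)" for n
    unfolding a_def k_def sum_lists_Suc sum_distrib_left sum.distrib[symmetric]
    by (rule sum_mono[OF drift])
  have total: "ennreal \<eta> * (\<Sum>n<N. a n) + (\<Sum>n<N. k n) + (\<Sum>p\<in>?L N. u p) \<le> \<Phi> S" for N
  proof (induction N)
    case 0
    have "u [] \<le> (\<integral>\<^sup>+\<omega>. \<Phi> S \<partial>tree_law D)"
      unfolding u_def by (intro nn_integral_mono) (auto simp: indicator_def)
    then show ?case by (simp add: emeasure_space_1)
  next
    case (Suc N)
    have "ennreal \<eta> * (\<Sum>n<Suc N. a n) + (\<Sum>n<Suc N. k n) + (\<Sum>p\<in>?L (Suc N). u p)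
        = ennreal \<eta> * (\<Sum>n<N. a n) + (\<Sum>n<N. k n) + (ennreal \<eta> * a N + k N + (\<Sum>p\<in>?L (Suc N). u p))"
      by (simp add: distrib_left ac_simps)
    also have "\<dots> \<le> ennreal \<eta> * (\<Sum>n<N. a n) + (\<Sum>n<N. k n) + (\<Sum>p\<in>?L N. u p)"
      by (intro add_left_mono level)
    also have "\<dots> \<le> \<Phi> S" by (rule Suc.IH)
    finally show ?case .
  qed
  let ?bad = "{\<omega> \<in> space (tree_law D). \<not> (\<exists>C\<in>rptree_max_cells D S pick \<omega>. B \<subseteq> C \<and> ediam D C \<le> T)}"
  \<comment> \<open>In a bad outcome every node of the tree containing \<open>B\<close> is alive.
    Following these nodes downwards from the root, \<open>B\<close> is either cut above depth
    \<open>N\<close> or still alive at depth \<open>N\<close>.\<close>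
  have follow: "(\<exists>n<N. \<exists>p\<in>?L n. \<omega> \<in> Cut p) \<or> (\<exists>p\<in>?L N. \<omega> \<in> Ev p \<and> is_node D S pick \<omega> p)"
    if \<omega>: "\<omega> \<in> ?bad" for \<omega> N
  proof (induction N)
    case 0
    have "is_node D S pick \<omega> []" by (simp add: is_node_def)
    moreover from this have "S \<in> rptree_max_cells D S pick \<omega>"
      unfolding rptree_max_cells_def using cell_data.simps(1) by blast
    then have "\<omega> \<in> Ev []" using \<omega> B by (auto simp: Ev_def alive_def not_le)
    ultimately show ?case by auto
  next
    case (Suc N)
    then consider n p where "n < N" "p \<in> ?L n" "\<omega> \<in> Cut p"
      | p where "p \<in> ?L N" "\<omega> \<in> Ev p" "is_node D S pick \<omega> p" by auto
    then show ?case
    proof cases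
      case 1
      then show ?thesis using less_Suc_eq by blast
    next
      case 2
      show ?thesis
      proof (cases "\<omega> \<in> Cut p")
        case True
        then show ?thesis using 2 by blast
      next
        case False
        then obtain b where b: "B \<subseteq> ?c \<omega> (b # p)" using 2 by (auto simp: Cut_def Ev_def)
        have al: "B \<subseteq> ?c \<omega> p" "T < ediam D (?c \<omega> p)" using 2 by (auto simp: Ev_def alive_def)
        have "finite (?c \<omega> p)" by (rule finite_cell_data[OF S])
        then have "2 \<le> card (?c \<omega> p)" using al B(2) T by (intro two_le_card_if_ediam_pos[of _ D]) auto
        then have node: "is_node D S pick \<omega> (b # p)" using 2 by (simp add: is_node_Cons)
        then have "?c \<omega> (b # p) \<in> rptree_max_cells D S pick \<omega>" unfolding rptree_max_cells_def by blast
        then have "\<omega> \<in> Ev (b # p)" using \<omega> b by (auto simp: Ev_def alive_def not_le)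
        moreover have "b # p \<in> ?L (Suc N)" using 2 by simp
        ultimately show ?thesis using node by blast
      qed
    qed
  qed
  have bad_le: "emeasure (tree_law D) ?bad \<le> \<Phi> S + a N" for N
  proof -
    have "emeasure (tree_law D) ?bad
        \<le> emeasure (tree_law D) ((\<Union>n<N. \<Union>p\<in>?L n. Cut p) \<union> (\<Union>p\<in>?L N. Ev p))"
    proof (rule emeasure_mono)
      show "?bad \<subseteq> (\<Union>n<N. \<Union>p\<in>?L n. Cut p) \<union> (\<Union>p\<in>?L N. Ev p)"
      proof
        fix \<omega> assume "\<omega> \<in> ?bad"
        from follow[OF this, of N] show "\<omega> \<in> (\<Union>n<N. \<Union>p\<in>?L n. Cut p) \<union> (\<Union>p\<in>?L N. Ev p)" by auto
      qed
    qed (use finL in \<open>auto intro!: sets.finite_UN\<close>)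
    also have "\<dots> \<le> emeasure (tree_law D) (\<Union>n<N. \<Union>p\<in>?L n. Cut p) + emeasure (tree_law D) (\<Union>p\<in>?L N. Ev p)"
      using finL by (intro emeasure_subadditive) (auto intro!: sets.finite_UN)
    also have "\<dots> \<le> (\<Sum>n<N. k n) + a N"
    proof (rule add_mono)
      have "emeasure (tree_law D) (\<Union>n<N. \<Union>p\<in>?L n. Cut p)
          \<le> (\<Sum>n<N. emeasure (tree_law D) (\<Union>p\<in>?L n. Cut p))"
        using finL by (intro emeasure_subadditive_finite) (auto intro!: sets.finite_UN)
      also have "\<dots> \<le> (\<Sum>n<N. k n)"
        unfolding k_def using finL by (intro sum_mono emeasure_subadditive_finite) auto
      finally show "emeasure (tree_law D) (\<Union>n<N. \<Union>p\<in>?L n. Cut p) \<le> (\<Sum>n<N. k n)" .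
      show "emeasure (tree_law D) (\<Union>p\<in>?L N. Ev p) \<le> a N"
        unfolding a_def using finL by (intro emeasure_subadditive_finite) auto
    qed
    also have "(\<Sum>n<N. k n) \<le> \<Phi> S"
    proof -
      have "(\<Sum>n<N. k n) \<le> ennreal \<eta> * (\<Sum>n<N. a n) + (\<Sum>n<N. k n) + (\<Sum>p\<in>?L N. u p)"
        by (rule add_increasing2[OF zero_le add_increasing[OF zero_le order_refl]])
      then show ?thesis using total[of N] by (rule order_trans)
    qed
    finally show ?thesis by (simp add: add_right_mono)
  qed
  show ?thesis
  proof (cases "\<Phi> S = \<infinity>")
    case False
    then obtain \<phi> where \<phi>: "0 \<le> \<phi>" "\<Phi> S = ennreal \<phi>" by (cases "\<Phi> S") auto
    have a_fin: "a n < \<infinity>" for n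
      unfolding a_def using finL by (simp add: less_top[symmetric])
    define a' where "a' n = enn2real (a n)" for n
    have a': "a n = ennreal (a' n)" "0 \<le> a' n" for n
      using a_fin[of n] by (auto simp: a'_def)
    \<comment> \<open>The payments of \<open>\<eta>\<close> bound the sum of all \<open>a n\<close>
      by a finite number. Thus \<open>a n\<close> tends to 0 and the error term of
      \<open>bad_le\<close> vanishes in the limit.\<close>
    have "(\<Sum>n<N. a' n) \<le> \<phi> / \<eta>" for N
    proof -
      have "ennreal (\<eta> * (\<Sum>n<N. a' n)) = ennreal \<eta> * (\<Sum>n<N. a n)"
        using \<eta> a' by (simp add: ennreal_mult sum_nonneg sum_ennreal)
      also have "\<dots> \<le> ennreal \<eta> * (\<Sum>n<N. a n) + (\<Sum>n<N. k n) + (\<Sum>p\<in>?L N. u p)"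
        by (rule add_increasing2[OF zero_le add_increasing2[OF zero_le order_refl]])
      also have "\<dots> \<le> ennreal \<phi>" using total[of N] \<phi> by simp
      finally show ?thesis using \<eta> \<phi>(1) by (simp add: pos_le_divide_eq mult.commute)
    qed
    then have "summable a'" using a'(2) by (intro summableI_nonneg_bounded)
    then have "a' \<longlonglongrightarrow> 0" by (rule summable_LIMSEQ_zero)
    then have "(\<lambda>n. \<phi> + a' n) \<longlonglongrightarrow> \<phi> + 0" by (intro tendsto_add tendsto_const)
    moreover have "measure (tree_law D) ?bad \<le> \<phi> + a' n" for n
      using bad_le[of n] a'[of n] \<phi>(1) by (simp add: \<phi>(2) emeasure_eq_measure ennreal_plus[symmetric] del: ennreal_plus)
    ultimately have "measure (tree_law D) ?bad \<le> \<phi>"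
      using LIMSEQ_le_const[of "\<lambda>n. \<phi> + a' n" \<phi>] by auto
    then show ?thesis by (simp add: \<phi>(2) emeasure_eq_measure ennreal_leI)
  qed simp
qed

section \<open>The potential of separated pairs\<close>

definition psi :: "nat \<Rightarrow> real" where
  "psi m = (if m = 0 then 0 else 1 + ln (real m))"

lemma psi_nonneg: "0 \<le> psi m"
  by (simp add: psi_def)

lemma psi_mono: "m \<le> n \<Longrightarrow> psi m \<le> psi n"
  by (auto simp: psi_def)

text \<open>The tangent line at \<open>M\<close> of the concave part of \<open>psi\<close> also dominates \<open>psi\<close> at \<open>0\<close>, so a drop of
  the mean of \<open>m\<close> by a factor \<open>1 - p\<close> lowers the mean of \<open>psi\<close> by at least \<open>p\<close>.\<close>

lemma psi_le_tangent:
  assumes "1 \<le> M"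
  shows "psi m \<le> ln (real M) + real m / real M"
proof (cases "m = 0")
  case True
  then show ?thesis using assms by (simp add: psi_def)
next
  case False
  then have "ln (real m / real M) \<le> real m / real M - 1" using assms by (intro ln_le_minus_one) simp
  then show ?thesis using False assms by (simp add: psi_def ln_div)
qed

definition meets :: "nat \<Rightarrow> real \<Rightarrow> (nat \<Rightarrow> real) set \<Rightarrow> (nat \<Rightarrow> real) \<times> (nat \<Rightarrow> real) \<Rightarrow> bool" where
  "meets D e X yy \<longleftrightarrow> X \<inter> closed_ball D (fst yy) e \<noteq> {} \<and> X \<inter> closed_ball D (snd yy) e \<noteq> {}"

definition pair_count ::
  "nat \<Rightarrow> real \<Rightarrow> ((nat \<Rightarrow> real) \<times> (nat \<Rightarrow> real)) set \<Rightarrow> (nat \<Rightarrow> real) set \<Rightarrow> nat" where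
  "pair_count D e P X = card {yy \<in> P. meets D e X yy}"

lemma pair_count_mono:
  assumes "finite P" "X \<subseteq> Y"
  shows "pair_count D e P X \<le> pair_count D e P Y"
  unfolding pair_count_def meets_def using assms by (intro card_mono) auto

text \<open>For \<open>z\<close> in \<open>X\<close> this is the child holding \<open>z\<close>.
  Unlike a child holding the ball, it exists after every split, so the decrease of the pair counts
  can be averaged over all splits, including those that cut the ball.\<close>

definition containing_child ::
  "nat \<Rightarrow> (nat \<Rightarrow> real) set \<Rightarrow> (nat \<Rightarrow> real) \<Rightarrow> (nat \<Rightarrow> real) \<Rightarrow> (nat \<Rightarrow> real) \<times> real \<Rightarrow> (nat \<Rightarrow> real) set" where
  "containing_child D X z x0 s =
    (if z \<in> child D X x0 s True then child D X x0 s True else child D X x0 s False)"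

lemma containing_child_subset: "containing_child D X z x0 s \<subseteq> X"
  by (simp add: containing_child_def child_subset)

lemma borel_measurable_containing_child:
  "finite X \<Longrightarrow> (\<lambda>s. f (containing_child D X z x0 s)) \<in> borel_measurable (split_law D)"
  using borel_measurable_children[of X "\<lambda>Y Z. f (if z \<in> Y then Y else Z)" D x0]
  by (simp add: containing_child_def)

lemma integrable_psi_containing_child:
  assumes D: "1 \<le> D" and fin: "finite P" "finite X"
  shows "integrable (split_law D) (\<lambda>s. psi (pair_count D e P (containing_child D X z x0 s)))"
proof -
  interpret P: prob_space "split_law D" by (rule prob_space_split_law[OF D])
  show ?thesis
  proof (rule P.integrable_const_bound)
    show "AE s in split_law D. norm (psi (pair_count D e P (containing_child D X z x0 s)))
        \<le> psi (pair_count D e P X)"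
      using psi_nonneg psi_mono[OF pair_count_mono[OF fin(1) containing_child_subset]] by simp
  qed (rule borel_measurable_containing_child[OF fin(2)])
qed

text \<open>\<open>P\<close> lists the obstructions to a diameter of at most \<Delta> / 2. It is
  fixed for all cells containing \<open>z\<close> at this scale, so the number of pairs that still
  meet the cell can only decrease down the tree; the separation of \<Delta> / 4 is what gives every
  split a constant chance to destroy a given pair.\<close>

definition scale_pairs ::
  "nat \<Rightarrow> nat \<Rightarrow> (nat \<Rightarrow> real) set \<Rightarrow> (nat \<Rightarrow> real) \<Rightarrow> real \<Rightarrow> real \<Rightarrow>
    ((nat \<Rightarrow> real) \<times> (nat \<Rightarrow> real)) set \<Rightarrow> bool" where
  "scale_pairs D d S z \<Delta> e P \<longleftrightarrow> finite P \<and> P \<subseteq> Rn D \<times> Rn D \<and> 0 < e \<and> e * 2 ^ 18 * sqrt d \<le> \<Delta> \<and>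
    (\<forall>X. X \<subseteq> S \<longrightarrow> z \<in> X \<longrightarrow> \<Delta> / 2 < ediam D X \<longrightarrow> ediam D X \<le> \<Delta> \<longrightarrow> (\<exists>yy\<in>P. meets D e X yy)) \<and>
    (\<forall>yy\<in>P. \<forall>a\<in>S \<inter> closed_ball D (fst yy) e. \<forall>b\<in>S \<inter> closed_ball D (snd yy) e. \<Delta> / 4 \<le> edist D a b)"

lemma scale_pairs_exist:
  assumes d: "1 \<le> d" and S: "finite S" "S \<subseteq> Rn D" "doubling D d S" and z: "z \<in> S" and \<Delta>: "0 < \<Delta>"
  shows "\<exists>e P. scale_pairs D d S z \<Delta> e P \<and> psi (card P) \<le> 42 * (real d * ln (real (max 2 d)))"
proof -
  \<comment> \<open>The maximum with 2 keeps the logarithm at least ln 2, so that \<open>l\<close>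
    absorbs additive constants also for d = 1.\<close>
  define l where "l = ln (real (max 2 d))"
  have ln2: "1 / 2 \<le> ln (2::real)" using ln_2_less_1 ln2_ge_two_thirds by simp
  have l2: "ln 2 \<le> l" unfolding l_def by (subst ln_le_cancel_iff) auto
  have dl: "1 / 2 \<le> real d * l"
    using mult_mono[of 1 "real d" "1 / 2" l] d ln2 l2 by simp
  define j where "j = nat \<lceil>log 2 (real d)\<rceil>"
  have logd: "0 \<le> log 2 (real d)" using d by simp
  \<comment> \<open>The number of halvings from \<Delta> down to \<open>e\<close>: 18 for the
    constant 2^18, and \<open>j\<close> for sqrt d. The bound sqrt d \<le> d \<le> 2^j is wasteful,
    but this affects the logarithm by a constant factor only.\<close>
  define k where "k = 18 + j"
  have "real d = 2 powr (log 2 (real d))" using d by simp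
  also have "\<dots> \<le> 2 powr (real j)" using logd by (intro powr_mono) (auto simp: j_def)
  finally have dj: "real d \<le> 2 ^ j" by (simp add: powr_realpow)
  have "real j \<le> log 2 (real d) + 1" using logd by (simp add: j_def)
  then have "real j * ln 2 \<le> (log 2 (real d) + 1) * ln 2" by (intro mult_right_mono) auto
  also have "\<dots> = ln (real d) + ln 2" by (simp add: log_def field_simps)
  also have "ln (real d) \<le> l" unfolding l_def using d by (subst ln_le_cancel_iff) auto
  finally have kl: "real k * ln 2 \<le> 20 * l" using l2 by (simp add: k_def algebra_simps)
  define e where "e = \<Delta> / 2 ^ k"
  have e: "0 < e" using \<Delta> by (simp add: e_def)
  have "sqrt d \<le> d" using d by (intro real_le_lsqrt) (auto simp: power2_eq_square)
  from order_trans[OF this dj] have ek: "2 ^ 18 * sqrt d \<le> 2 ^ k" by (simp add: k_def power_add)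
  have e_le: "e * 2 ^ 18 * sqrt d \<le> \<Delta>"
  proof -
    have "e * (2 ^ 18 * sqrt d) \<le> e * 2 ^ k" using ek e by (intro mult_left_mono) auto
    then show ?thesis by (simp add: e_def)
  qed
  \<comment> \<open>Replacing both points of a pair by other points of their balls changes the
    distance by at most 4 e.\<close>
  have e16: "4 * e \<le> \<Delta> / 4"
  proof -
    have "e * 2 ^ 18 * 1 \<le> e * 2 ^ 18 * sqrt d" using e d by (intro mult_left_mono) auto
    from order_trans[OF this e_le] have "e * 2 ^ 18 \<le> \<Delta>" by simp
    with e show ?thesis by simp
  qed
  have zR: "z \<in> Rn D" using S z by auto
  \<comment> \<open>A cover around \<open>z\<close> suffices, since the cells in question contain
    \<open>z\<close> and have diameter at most \<Delta>.\<close>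
  obtain Y where Y: "Y \<subseteq> Rn D" "finite Y" "card Y \<le> 2 ^ (d * k)"
    "closed_ball D z \<Delta> \<inter> S \<subseteq> (\<Union>y\<in>Y. closed_ball D y e)"
    using doubling_cover[OF S(3) zR \<Delta>, of k] unfolding e_def by blast
  \<comment> \<open>One witness at distance above \<Delta> / 2 keeps all data of the two balls at
    least \<Delta> / 2 - 4 e \<ge> \<Delta> / 4 apart, and no pair is lost that realises a diameter
    above \<Delta> / 2.\<close>
  define P where "P = {yy \<in> Y \<times> Y. \<exists>a\<in>S \<inter> closed_ball D (fst yy) e. \<exists>b\<in>S \<inter> closed_ball D (snd yy) e.
    \<Delta> / 2 < edist D a b}"
  have finP: "finite P" using Y by (simp add: P_def)
  have "psi (card P) \<le> 42 * (real d * l)"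
  proof -
    have "card P \<le> card (Y \<times> Y)" unfolding P_def using Y by (intro card_mono) auto
    also have "\<dots> \<le> 2 ^ (d * k) * 2 ^ (d * k)"
      unfolding card_cartesian_product using Y by (intro mult_mono) auto
    also have "\<dots> = 2 ^ (2 * (d * k))" by (simp add: power_add[symmetric] mult_2)
    finally have "psi (card P) \<le> psi (2 ^ (2 * (d * k)))" by (rule psi_mono)
    also have "\<dots> = 1 + 2 * real d * (real k * ln 2)" by (simp add: psi_def ln_realpow)
    also have "\<dots> \<le> 1 + 2 * real d * (20 * l)" using kl by (intro add_left_mono mult_left_mono) auto
    \<comment> \<open>Here 1 \<le> 2 d l turns the additive 1 into the step from 40 to 42.\<close>
    also have "\<dots> \<le> 42 * (real d * l)" using dl by (simp add: algebra_simps)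
    finally show ?thesis .
  qed
  moreover have "scale_pairs D d S z \<Delta> e P"
    unfolding scale_pairs_def
  proof (intro conjI allI impI ballI)
    fix X assume X: "X \<subseteq> S" "z \<in> X" "\<Delta> / 2 < ediam D X" "ediam D X \<le> \<Delta>"
    have finX: "finite X" using X S finite_subset by blast
    obtain a b where ab: "a \<in> X" "b \<in> X" "ediam D X = edist D a b"
      using ediam_attained[OF finX] X(2) by blast
    have near: "\<exists>y\<in>Y. c \<in> closed_ball D y e" if c: "c \<in> X" for c
    proof -
      have "edist D z c \<le> \<Delta>" using edist_le_ediam[OF finX X(2) c, of D] X(4) by linarith
      then have "c \<in> closed_ball D z \<Delta> \<inter> S" using c X S by (auto simp: closed_ball_def)
      then show ?thesis using Y(4) by blast
    qed
    obtain y y' where y: "y \<in> Y" "a \<in> closed_ball D y e" "y' \<in> Y" "b \<in> closed_ball D y' e"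
      using near ab by blast
    have "(y, y') \<in> P" unfolding P_def using y ab X by auto
    moreover have "meets D e X (y, y')" unfolding meets_def using y ab by auto
    ultimately show "\<exists>yy\<in>P. meets D e X yy" by blast
  next
    fix yy a b assume yy: "yy \<in> P" "a \<in> S \<inter> closed_ball D (fst yy) e" "b \<in> S \<inter> closed_ball D (snd yy) e"
    then obtain a' b' where ab': "a' \<in> closed_ball D (fst yy) e" "b' \<in> closed_ball D (snd yy) e"
      "\<Delta> / 2 < edist D a' b'" by (auto simp: P_def)
    have ball: "edist D c c' \<le> 2 * e" if "c \<in> closed_ball D y e" "c' \<in> closed_ball D y e" for c c' y
      using that edist_triangle[of D c c' y] by (simp add: closed_ball_def edist_commute[of D c y])
    have "edist D a' b' \<le> edist D a' a + edist D a b + edist D b b'"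
      using edist_triangle[of D a' b' a] edist_triangle[of D a b' b] by linarith
    then show "\<Delta> / 4 \<le> edist D a b"
      using ball[of a' "fst yy" a] ball[of b "snd yy" b'] yy ab' e16 by auto
  qed (use finP Y e e_le in \<open>auto simp: P_def\<close>)
  ultimately show ?thesis unfolding l_def by blast
qed

lemma psi_drift:
  assumes D: "1 \<le> D" and d: "1 \<le> d" and S: "finite S" "doubling D d S"
    and pairs: "scale_pairs D d S z \<Delta> e P"
    and X: "X \<subseteq> S" "x0 \<in> X" "z \<in> X" "\<Delta> / 2 < ediam D X" "ediam D X \<le> \<Delta>"
  shows "(\<integral>s. psi (pair_count D e P (containing_child D X z x0 s)) \<partial>split_law D)
    \<le> psi (pair_count D e P X) - 1 / 2592"
proof -
  interpret P: prob_space "split_law D" by (rule prob_space_split_law[OF D])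
  have finX: "finite X" using X S finite_subset by blast
  have P: "finite P" "P \<subseteq> Rn D \<times> Rn D" "0 < e" "e * 2 ^ 18 * sqrt d \<le> \<Delta>"
    and P_meets: "\<exists>yy\<in>P. meets D e X yy"
    and P_far: "\<And>yy a b. yy \<in> P \<Longrightarrow> a \<in> S \<inter> closed_ball D (fst yy) e \<Longrightarrow>
      b \<in> S \<inter> closed_ball D (snd yy) e \<Longrightarrow> \<Delta> / 4 \<le> edist D a b"
    using pairs X unfolding scale_pairs_def by blast+
  let ?zc = "containing_child D X z x0"
  define Q where "Q = {yy \<in> P. meets D e X yy}"
  define M where "M = card Q"
  have finQ: "finite Q" using P by (simp add: Q_def)
  have M: "1 \<le> M" using P_meets finQ by (auto simp: M_def Q_def Suc_le_eq card_gt_0_iff)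
  define Sep where "Sep yy = {s \<in> space (split_law D).
    \<forall>c. child D X x0 s c \<inter> (X \<inter> closed_ball D (fst yy) e) = {}
      \<or> child D X x0 s c \<inter> (X \<inter> closed_ball D (snd yy) e) = {}}" for yy
  have Sep [measurable]: "Sep yy \<in> sets (split_law D)" for yy
  proof -
    let ?R = "\<lambda>Y. Y \<inter> (X \<inter> closed_ball D (fst yy) e) = {} \<or> Y \<inter> (X \<inter> closed_ball D (snd yy) e) = {}"
    have "Sep yy = {s \<in> space (split_law D). ?R (child D X x0 s True)}
        \<inter> {s \<in> space (split_law D). ?R (child D X x0 s False)}"
      by (auto simp: Sep_def all_bool_eq)
    also have "\<dots> \<in> sets (split_law D)" by (intro sets.Int pred_child[OF finX])
    finally show ?thesis .
  qed
  have sep: "1 / 2592 \<le> measure (split_law D) (Sep yy)" if yy: "yy \<in> Q" for yy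
  proof -
    have yyP: "yy \<in> P" and "meets D e X yy" using yy by (auto simp: Q_def)
    then obtain a b where ab: "a \<in> X \<inter> closed_ball D (fst yy) e" "b \<in> X \<inter> closed_ball D (snd yy) e"
      unfolding meets_def by blast
    then have "\<Delta> / 4 \<le> edist D a b" using P_far[OF yyP, of a b] X by blast
    moreover have "fst yy \<in> Rn D" "snd yy \<in> Rn D" using P(2) yyP by auto
    ultimately show ?thesis
      unfolding Sep_def
      using separation_probability[OF D d S X(1,2,5) _ _ P(3,4) order_refl order_refl ab] by blast
  qed
  \<comment> \<open>Linearising at the current count \<open>M\<close> reduces the mean of
    \<open>psi\<close> to a sum over the pairs, for which the separation probability of each single
    pair is enough.\<close>
  let ?G = "\<lambda>s. ln (real M) + (\<Sum>yy\<in>Q. 1 - indicator (Sep yy) s) / real M"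
  have "(\<integral>s. psi (pair_count D e P (?zc s)) \<partial>split_law D) \<le> (\<integral>s. ?G s \<partial>split_law D)"
  proof (rule integral_mono)
    show "integrable (split_law D) (\<lambda>s. psi (pair_count D e P (?zc s)))"
      by (rule integrable_psi_containing_child[OF D P(1) finX])
    show "integrable (split_law D) ?G" by (auto simp: less_top[symmetric])
    fix s assume s: "s \<in> space (split_law D)"
    have "psi (pair_count D e P (?zc s)) \<le> ln (real M) + real (pair_count D e P (?zc s)) / real M"
      by (rule psi_le_tangent[OF M])
    also have "real (pair_count D e P (?zc s)) \<le> (\<Sum>yy\<in>Q. 1 - indicator (Sep yy) s)"
    proof -
      have "{yy \<in> P. meets D e (?zc s) yy} \<subseteq> {yy \<in> Q. s \<notin> Sep yy}"
      proof
        fix yy assume yy: "yy \<in> {yy \<in> P. meets D e (?zc s) yy}"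
        have sub: "?zc s \<subseteq> X" by (rule containing_child_subset)
        have "\<exists>c. ?zc s = child D X x0 s c"
          by (cases "z \<in> child D X x0 s True") (auto simp: containing_child_def)
        then obtain c where c: "?zc s = child D X x0 s c" ..
        have "s \<notin> Sep yy"
        proof
          assume "s \<in> Sep yy"
          then have "?zc s \<inter> (X \<inter> closed_ball D (fst yy) e) = {} \<or> ?zc s \<inter> (X \<inter> closed_ball D (snd yy) e) = {}"
            unfolding c by (simp add: Sep_def)
          then show False using yy sub unfolding meets_def by blast
        qed
        moreover have "yy \<in> Q" using yy sub unfolding Q_def meets_def by blast
        ultimately show "yy \<in> {yy \<in> Q. s \<notin> Sep yy}" by simp
      qed
      then have "pair_count D e P (?zc s) \<le> card {yy \<in> Q. s \<notin> Sep yy}"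
        unfolding pair_count_def using finQ by (intro card_mono) auto
      also have "real (card {yy \<in> Q. s \<notin> Sep yy}) = (\<Sum>yy\<in>Q. if s \<notin> Sep yy then 1 else 0)"
        using finQ by (simp add: sum.If_cases Int_def)
      also have "\<dots> = (\<Sum>yy\<in>Q. 1 - indicator (Sep yy) s)"
        by (intro sum.cong) auto
      finally show ?thesis by simp
    qed
    finally show "psi (pair_count D e P (?zc s)) \<le> ?G s"
      using M by (simp add: divide_right_mono)
  qed
  also have "\<dots> = ln (real M) + (\<Sum>yy\<in>Q. 1 - measure (split_law D) (Sep yy)) / real M"
    by (simp add: less_top[symmetric] P.prob_space)
  also have "\<dots> \<le> ln (real M) + (real M * (1 - 1 / 2592)) / real M"
  proof (intro add_left_mono divide_right_mono)
    show "(\<Sum>yy\<in>Q. 1 - measure (split_law D) (Sep yy)) \<le> real M * (1 - 1 / 2592)"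
      unfolding M_def using sep by (intro sum_bounded_above) auto
  qed simp
  also have "\<dots> = psi (pair_count D e P X) - 1 / 2592"
    using M by (simp add: psi_def pair_count_def M_def Q_def)
  finally show ?thesis .
qed

lemma half_geometric_sum_le: "(\<Sum>j<n. 1 / 2 ^ j) \<le> (2::real)"
proof -
  have "(\<Sum>j<n. 1 / 2 ^ j) = 2 - 2 / (2::real) ^ n"
    by (induction n) (auto simp: field_simps)
  then show ?thesis by simp
qed

lemma dyadic_scale_exists:
  fixes t :: real
  assumes "T < t" "t \<le> T * 2 ^ J"
  obtains j where "j < J" "T * 2 ^ j < t" "t \<le> T * 2 ^ Suc j"
proof -
  have "\<exists>j<J. T * 2 ^ j < t \<and> t \<le> T * 2 ^ Suc j"
    using assms
  proof (induction J)
    case (Suc J)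
    show ?case
    proof (cases "t \<le> T * 2 ^ J")
      case True
      then show ?thesis using Suc.IH[OF Suc.prems(1)] less_Suc_eq by blast
    next
      case False
      then show ?thesis using Suc.prems by (intro exI[of _ J]) auto
    qed
  qed simp
  then show ?thesis using that by blast
qed

lemma good_cell_probability:
  assumes D: "1 \<le> D" and d: "1 \<le> d" and S: "finite S" "S \<subseteq> Rn D" "doubling D d S"
    and pick: "valid_selection D S pick" and x: "x \<in> Rn D" and R: "0 < R"
    and B: "B \<subseteq> S \<inter> closed_ball D x R" "B \<noteq> {}"
    and T: "T = 66189312 * (R * real d * sqrt (real d) * ln (real (max 2 d)))"
  shows "7 / 8 \<le> measure (tree_law D) {\<omega> \<in> space (tree_law D).
    \<exists>C\<in>rptree_max_cells D S pick \<omega>. B \<subseteq> C \<and> ediam D C \<le> T}"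
proof -
  interpret Tr: prob_space "tree_law D" by (rule prob_space_tree_law[OF D])
  interpret P: prob_space "split_law D" by (rule prob_space_split_law[OF D])
  obtain z where z: "z \<in> B" using B by auto
  have zS: "z \<in> S" using z B by auto
  define l where "l = ln (real (max 2 d))"
  have l: "0 < l" by (simp add: l_def)
  have d0: "0 < real d" using d by simp
  have T0: "0 < T" using R d0 l unfolding T l_def[symmetric] by simp
  have "\<exists>e P. scale_pairs D d S z (T * 2 ^ Suc j) e P \<and> psi (card P) \<le> 42 * (real d * l)" for j
    unfolding l_def using T0 by (intro scale_pairs_exist[OF d S zS]) simp
  then obtain e P where pairs: "\<And>j. scale_pairs D d S z (T * 2 ^ Suc j) (e j) (P j)"
    and card_P: "\<And>j. psi (card (P j)) \<le> 42 * (real d * l)" by metis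
  have finP: "finite (P j)" for j using pairs[of j] by (simp add: scale_pairs_def)
  \<comment> \<open>The number of scales depends on \<open>S\<close>. It affects the drift
    \<open>c / 2 ^ J\<close> but not the bound on the initial potential, because the weights of the
    scales are summable.\<close>
  obtain J where J: "ediam D S \<le> T * 2 ^ J"
  proof -
    obtain J where "ediam D S / T < 2 ^ J" using real_arch_pow[of 2 "ediam D S / T"] by auto
    then have "ediam D S \<le> T * 2 ^ J" using T0 by (simp add: pos_divide_less_eq mult.commute)
    then show ?thesis by (rule that)
  qed
  \<comment> \<open>A cell of diameter above \<open>T * 2 ^ i\<close> is cut with probability at
    most \<open>c / 2 ^ i\<close>.\<close>
  define c where "c = 19 * R * sqrt d / T"
  have c: "0 < c" using R d0 T0 by (simp add: c_def)
  \<comment> \<open>At the scale \<open>i\<close> of the current diameter \<open>psi\<close> falls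
    by 1/2592 in mean, so the potential falls by 2 c / 2^i: one half pays for the cut, the other for
    the drift \<open>c / 2 ^ J\<close>.\<close>
  define \<kappa> where "\<kappa> = 2 * 2592 * c"
  have \<kappa>: "0 < \<kappa>" using c by (simp add: \<kappa>_def)
  define ps where "ps j X = psi (pair_count D (e j) (P j) X)" for j X
  define \<Phi> where "\<Phi> X = \<kappa> * (\<Sum>j<J. ps j X / 2 ^ j)" for X
  have ps_nonneg: "0 \<le> ps j X" for j X by (simp add: ps_def psi_nonneg)
  have \<Phi>_nonneg: "0 \<le> \<Phi> X" for X using \<kappa> ps_nonneg by (simp add: \<Phi>_def sum_nonneg)
  have \<Phi>_S: "\<Phi> S \<le> 1 / 8"
  proof -
    have "ps j S \<le> 42 * (real d * l)" for j
    proof -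
      have "ps j S \<le> psi (card (P j))"
        unfolding ps_def pair_count_def using finP by (intro psi_mono card_mono) auto
      with card_P[of j] show ?thesis by linarith
    qed
    then have "(\<Sum>j<J. ps j S / 2 ^ j) \<le> (\<Sum>j<J. 42 * (real d * l) * (1 / 2 ^ j))"
      by (intro sum_mono) (auto intro: divide_right_mono)
    also have "\<dots> = 42 * (real d * l) * (\<Sum>j<J. 1 / 2 ^ j)" by (simp only: sum_distrib_left)
    also have "\<dots> \<le> 42 * (real d * l) * 2"
      using d0 l by (intro mult_left_mono half_geometric_sum_le) auto
    finally have "\<Phi> S \<le> \<kappa> * (42 * (real d * l) * 2)"
      unfolding \<Phi>_def using \<kappa> by (intro mult_left_mono) auto
    \<comment> \<open>The constant in \<open>T\<close> is 19 * (2 * 2592) * (42 * 2) * 8: cut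
      probability, inverse drift, initial value of \<open>psi\<close> summed over the scales, and
      the target 1/8.\<close>
    also have "\<dots> = 1 / 8"
      unfolding \<kappa>_def c_def T l_def[symmetric] using R d0 l by (simp add: field_simps)
    finally show ?thesis .
  qed
  have step: "ennreal (c / 2 ^ J) + (\<integral>\<^sup>+s. next_potential D B (\<lambda>X. ennreal (\<Phi> X)) X x0 s \<partial>split_law D)
      \<le> ennreal (\<Phi> X)"
    if X: "B \<subseteq> X" "X \<subseteq> S" "T < ediam D X" "x0 \<in> X" for X x0
  proof -
    have finX: "finite X" using X S finite_subset by blast
    have zX: "z \<in> X" using z X by auto
    have "ediam D X \<le> ediam D S" using S X zX by (intro ediam_mono) auto
    then have "ediam D X \<le> T * 2 ^ J" using J by linarith
    then obtain i where i: "i < J" "T * 2 ^ i < ediam D X" "ediam D X \<le> T * 2 ^ Suc i"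
      using dyadic_scale_exists[OF X(3)] by blast
    let ?zc = "containing_child D X z x0"
    define Cut where "Cut = {s \<in> space (split_law D). \<forall>b. \<not> B \<subseteq> child D X x0 s b}"
    have [measurable]: "Cut \<in> sets (split_law D)"
    proof -
      have "Cut = {s \<in> space (split_law D). \<not> B \<subseteq> child D X x0 s True}
          \<inter> {s \<in> space (split_law D). \<not> B \<subseteq> child D X x0 s False}"
        by (auto simp: Cut_def all_bool_eq)
      also have "\<dots> \<in> sets (split_law D)" by (intro sets.Int pred_child[OF finX])
      finally show ?thesis .
    qed
    have cut: "measure (split_law D) Cut \<le> c / 2 ^ i"
    proof -
      have "measure (split_law D) Cut \<le> 19 * R * sqrt d / ediam D X"
        unfolding Cut_def
        using X B T0 by (intro cut_probability[OF D d S(1,3) x R]) auto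
      also have "\<dots> \<le> 19 * R * sqrt d / (T * 2 ^ i)"
        using i R T0 by (intro divide_left_mono) (auto intro!: mult_pos_pos)
      finally show ?thesis by (simp add: c_def)
    qed
    have int: "integrable (split_law D) (\<lambda>s. ps j (?zc s))" for j
      unfolding ps_def by (rule integrable_psi_containing_child[OF D finP finX])
    have int_\<Phi>: "integrable (split_law D) (\<lambda>s. \<Phi> (?zc s))"
      unfolding \<Phi>_def using int by auto
    have drift: "(\<integral>s. ps j (?zc s) \<partial>split_law D) \<le> ps j X - (if j = i then 1 / 2592 else 0)" for j
    proof (cases "j = i")
      case True
      have "T * 2 ^ Suc i / 2 < ediam D X" using i by simp
      then show ?thesis
        using psi_drift[OF D d S(1,3) pairs X(2,4) zX, of i] i True by (simp add: ps_def)
    next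
      case False
      have "(\<integral>s. ps j (?zc s) \<partial>split_law D) \<le> (\<integral>s. ps j X \<partial>split_law D)"
        using int finP unfolding ps_def
        by (intro integral_mono psi_mono pair_count_mono containing_child_subset) auto
      then show ?thesis using False by (simp add: P.prob_space)
    qed
    have "(\<integral>s. \<Phi> (?zc s) \<partial>split_law D) = \<kappa> * (\<Sum>j<J. (\<integral>s. ps j (?zc s) \<partial>split_law D) / 2 ^ j)"
      unfolding \<Phi>_def using int by (simp add: Bochner_Integration.integral_sum)
    also have "\<dots> \<le> \<kappa> * (\<Sum>j<J. ps j X / 2 ^ j - (if j = i then 1 / 2592 / 2 ^ i else 0))"
    proof (intro mult_left_mono sum_mono)
      fix j
      have "(\<integral>s. ps j (?zc s) \<partial>split_law D) / 2 ^ j \<le> (ps j X - (if j = i then 1 / 2592 else 0)) / 2 ^ j"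
        by (intro divide_right_mono drift) simp
      also have "\<dots> = ps j X / 2 ^ j - (if j = i then 1 / 2592 / 2 ^ i else 0)"
        by (simp add: diff_divide_distrib)
      finally show "(\<integral>s. ps j (?zc s) \<partial>split_law D) / 2 ^ j
          \<le> ps j X / 2 ^ j - (if j = i then 1 / 2592 / 2 ^ i else 0)" .
    qed (use \<kappa> in simp)
    also have "\<dots> = \<Phi> X - 2 * (c / 2 ^ i)"
      using i(1) by (simp add: \<Phi>_def sum_subtractf right_diff_distrib \<kappa>_def)
    finally have E\<Phi>: "(\<integral>s. \<Phi> (?zc s) \<partial>split_law D) \<le> \<Phi> X - 2 * (c / 2 ^ i)" .
    \<comment> \<open>Without a cut, the child holding \<open>z\<close> is the one holding
      \<open>B\<close>; with a cut, the indicator alone covers the charge of 1.\<close>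
    have "(\<integral>\<^sup>+s. next_potential D B (\<lambda>X. ennreal (\<Phi> X)) X x0 s \<partial>split_law D)
        \<le> (\<integral>\<^sup>+s. ennreal (indicator Cut s + \<Phi> (?zc s)) \<partial>split_law D)"
    proof (rule nn_integral_mono)
      fix s assume s: "s \<in> space (split_law D)"
      show "next_potential D B (\<lambda>X. ennreal (\<Phi> X)) X x0 s \<le> ennreal (indicator Cut s + \<Phi> (?zc s))"
      proof (cases "s \<in> Cut")
        case True
        then have "next_potential D B (\<lambda>X. ennreal (\<Phi> X)) X x0 s = ennreal 1"
          by (simp add: next_potential_def Cut_def)
        also have "\<dots> \<le> ennreal (indicator Cut s + \<Phi> (?zc s))"
          using True \<Phi>_nonneg by (intro ennreal_leI) simp
        finally show ?thesis .
      next
        case False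
        then obtain b where b: "B \<subseteq> child D X x0 s b" using s by (auto simp: Cut_def)
        then have "z \<in> child D X x0 s b" using z by auto
        then have zb: "?zc s = child D X x0 s b" and nb: "\<not> B \<subseteq> child D X x0 s (\<not> b)"
          using z child_True_Int_child_False[of D X x0 s]
          by (cases b; auto simp: containing_child_def)+
        have "next_potential D B (\<lambda>X. ennreal (\<Phi> X)) X x0 s = ennreal (\<Phi> (?zc s))"
          using b nb unfolding zb next_potential_def by (cases b) auto
        then show ?thesis using False by simp
      qed
    qed
    also have "\<dots> = ennreal (measure (split_law D) Cut + (\<integral>s. \<Phi> (?zc s) \<partial>split_law D))"
      using int_\<Phi> \<Phi>_nonneg
      by (subst nn_integral_eq_integral) (auto simp: less_top[symmetric])
    finally have "ennreal (c / 2 ^ J) + (\<integral>\<^sup>+s. next_potential D B (\<lambda>X. ennreal (\<Phi> X)) X x0 s \<partial>split_law D)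
        \<le> ennreal (c / 2 ^ J) + ennreal (measure (split_law D) Cut + (\<integral>s. \<Phi> (?zc s) \<partial>split_law D))"
      by (rule add_left_mono)
    also have "\<dots> = ennreal (c / 2 ^ J + (measure (split_law D) Cut + (\<integral>s. \<Phi> (?zc s) \<partial>split_law D)))"
      using c \<Phi>_nonneg by (intro ennreal_plus[symmetric]) (auto intro!: add_nonneg_nonneg integral_nonneg)
    also have "\<dots> \<le> ennreal (\<Phi> X)"
    proof (rule ennreal_leI)
      have "c / 2 ^ J \<le> c / 2 ^ i"
        using c i(1) by (intro divide_left_mono power_increasing) auto
      with cut E\<Phi> show "c / 2 ^ J + (measure (split_law D) Cut + (\<integral>s. \<Phi> (?zc s) \<partial>split_law D)) \<le> \<Phi> X"
        by linarith
    qed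
    finally show ?thesis .
  qed
  let ?G = "{\<omega> \<in> space (tree_law D). \<exists>C\<in>rptree_max_cells D S pick \<omega>. B \<subseteq> C \<and> ediam D C \<le> T}"
  let ?N = "{\<omega> \<in> space (tree_law D). \<not> (\<exists>C\<in>rptree_max_cells D S pick \<omega>. B \<subseteq> C \<and> ediam D C \<le> T)}"
  have G: "?G \<in> sets (tree_law D)" by (rule sets_Collect_rptree_max_cells[OF S(1) pick])
  have "emeasure (tree_law D) ?N \<le> ennreal (\<Phi> S)"
    by (rule failure_probability_le_potential[OF D S(1) pick _ B(2) _ _ step])
      (use B T0 c in auto)
  also have "\<dots> \<le> ennreal (1 / 8)" by (rule ennreal_leI[OF \<Phi>_S])
  finally have "measure (tree_law D) ?N \<le> 1 / 8" by (simp add: Tr.emeasure_eq_measure)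
  moreover have "?N = space (tree_law D) - ?G" by auto
  ultimately show ?thesis using Tr.prob_compl[OF G] by simp
qed

section \<open>Radii, dimension zero and the final statement\<close>

lemma cell_radius_le:
  assumes "0 \<le> r" "x \<in> Rn D" "X \<subseteq> closed_ball D x r"
  shows "cell_radius D X \<le> r"
  unfolding cell_radius_def using assms by (intro cInf_lower bdd_belowI[of _ 0]) auto

lemma cell_radius_le_ediam:
  assumes "finite X" "X \<subseteq> Rn D" "X \<noteq> {}"
  shows "cell_radius D X \<le> ediam D X"
proof -
  obtain z where z: "z \<in> X" using assms by auto
  show ?thesis
  proof (rule cell_radius_le[of _ z])
    show "0 \<le> ediam D X" using edist_le_ediam[OF assms(1) z z, of D] by simp
    show "X \<subseteq> closed_ball D z (ediam D X)"
      using edist_le_ediam[OF assms(1) z, of _ D] assms(2) by (auto simp: closed_ball_def)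
  qed (use z assms in auto)
qed

text \<open>For d = 0 the claimed radius is 0, so the data must be a single point. Two distinct
  points would fit into one ball of a quarter of their distance, which is absurd.\<close>

lemma doubling_0_unique:
  assumes T: "doubling D 0 T" "T \<subseteq> Rn D" and ab: "a \<in> T" "b \<in> T"
  shows "a = b"
proof (rule ccontr)
  assume "a \<noteq> b"
  then have pos: "0 < edist D a b"
    using ab T(2) edist_eq_0_iff[of a D b] by (simp add: less_le subset_eq)
  obtain Y where Y: "finite Y" "card Y \<le> 1"
    "closed_ball D a (edist D a b) \<inter> T \<subseteq> (\<Union>y\<in>Y. closed_ball D y (edist D a b / 2 ^ 2))"
    \<comment> \<open>Two halvings are taken, because a ball of half the distance may still contain
      both points.\<close>
    using doubling_cover[OF T(1) _ pos, of a 2] ab T(2) by auto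
  have "a \<in> closed_ball D a (edist D a b) \<inter> T" "b \<in> closed_ball D a (edist D a b) \<inter> T"
    using ab T(2) by (auto simp: closed_ball_def)
  then obtain y y' where y: "y \<in> Y" "a \<in> closed_ball D y (edist D a b / 2 ^ 2)"
    "y' \<in> Y" "b \<in> closed_ball D y' (edist D a b / 2 ^ 2)" using Y(3) by blast
  moreover have "y = y'" using Y y card_le_Suc0_iff_eq[of Y] by auto
  ultimately have "edist D y a \<le> edist D a b / 4" "edist D y b \<le> edist D a b / 4"
    by (auto simp: closed_ball_def)
  with edist_triangle[of D a b y] edist_commute[of D a y] pos show False by linarith
qed

theorem theorem4:
  shows "\<exists>c::real. \<forall>(D::nat) (S::(nat \<Rightarrow> real) set) (d::nat) (pick::selection) (x::nat \<Rightarrow> real) (R::real).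
    1 \<le> D \<longrightarrow> S \<subseteq> Rn D \<longrightarrow> finite S \<longrightarrow> doubling_dim D S = d \<longrightarrow>
    valid_selection D S pick \<longrightarrow> x \<in> Rn D \<longrightarrow> 0 < R \<longrightarrow>
    measure (tree_law D)
      {\<omega> \<in> space (tree_law D). \<exists>C \<in> rptree_max_cells D S pick \<omega>.
         S \<inter> closed_ball D x R \<subseteq> C \<and>
         cell_radius D C \<le> c * (R * real d * sqrt (real d) * ln (real (max 2 d)))}
    > 1 - 1 / 4"
proof (intro exI[of _ 66189312] allI impI)
  fix D d :: nat and S :: "(nat \<Rightarrow> real) set" and pick :: selection and x :: "nat \<Rightarrow> real" and R :: real
  assume D: "1 \<le> D" and S: "S \<subseteq> Rn D" "finite S" and dim: "doubling_dim D S = d"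
    and pick: "valid_selection D S pick" and x: "x \<in> Rn D" and R: "0 < R"
  interpret prob_space "tree_law D" by (rule prob_space_tree_law[OF D])
  have dbl: "doubling D d S" using doubling_doubling_dim[OF S(2,1)] dim by simp
  define T where "T = 66189312 * (R * real d * sqrt (real d) * ln (real (max 2 d)))"
  let ?G = "{\<omega> \<in> space (tree_law D). \<exists>C \<in> rptree_max_cells D S pick \<omega>.
    S \<inter> closed_ball D x R \<subseteq> C \<and> cell_radius D C \<le> T}"
  have "1 - 1 / 4 < measure (tree_law D) ?G"
  \<comment> \<open>In these cases the root itself is a cell of radius 0.\<close>
  proof (cases "S = {} \<or> d = 0")
    case True
    have "cell_radius D S \<le> 0"
    proof (cases "S = {}")
      case True
      then show ?thesis using x by (intro cell_radius_le) auto
    next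
      case False
      then obtain a where a: "a \<in> S" by auto
      have "doubling D 0 S" using dbl True False by simp
      then have "S \<subseteq> closed_ball D a 0"
        using doubling_0_unique[OF _ S(1) a] S by (auto simp: closed_ball_def)
      then show ?thesis using a S by (intro cell_radius_le) auto
    qed
    moreover have "0 \<le> T" unfolding T_def using R by (intro mult_nonneg_nonneg) auto
    moreover have "S \<in> rptree_max_cells D S pick \<omega>" for \<omega>
    proof -
      have "is_node D S pick \<omega> []" by (simp add: is_node_def)
      then show ?thesis unfolding rptree_max_cells_def using cell_data.simps(1) by blast
    qed
    ultimately have "?G = space (tree_law D)" by fastforce
    then show ?thesis by (simp add: prob_space)
  next
    case False
    then have d: "1 \<le> d" and "S \<noteq> {}" by auto
    \<comment> \<open>A nonempty set is required for following a single cell. If the ball holds no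
      data, a single data point with the ball around it is followed instead.\<close>
    obtain B x' where B: "B \<subseteq> S \<inter> closed_ball D x' R" "B \<noteq> {}" "x' \<in> Rn D" "S \<inter> closed_ball D x R \<subseteq> B"
    proof (cases "S \<inter> closed_ball D x R = {}")
      case True
      obtain z where "z \<in> S" using \<open>S \<noteq> {}\<close> by auto
      then show ?thesis
        using that[of "{z}" z] True S(1) R by (auto simp: closed_ball_def)
    next
      case False
      then show ?thesis using that[of "S \<inter> closed_ball D x R" x] x by auto
    qed
    have "7 / 8 \<le> measure (tree_law D) {\<omega> \<in> space (tree_law D).
        \<exists>C\<in>rptree_max_cells D S pick \<omega>. B \<subseteq> C \<and> ediam D C \<le> T}"
      by (rule good_cell_probability[OF D d S(2,1) dbl pick B(3) R B(1,2) T_def])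
    also have "\<dots> \<le> measure (tree_law D) ?G"
    proof (rule finite_measure_mono)
      show "{\<omega> \<in> space (tree_law D). \<exists>C\<in>rptree_max_cells D S pick \<omega>. B \<subseteq> C \<and> ediam D C \<le> T} \<subseteq> ?G"
      proof safe
        fix \<omega> C assume C: "C \<in> rptree_max_cells D S pick \<omega>" "B \<subseteq> C" "ediam D C \<le> T"
        have CS: "C \<subseteq> S" using C(1) unfolding rptree_max_cells_def by (auto intro: subsetD[OF cell_data_subset])
        have "cell_radius D C \<le> ediam D C"
          using finite_subset[OF CS S(2)] CS S(1) C(2) B(2) by (intro cell_radius_le_ediam) auto
        then show "\<exists>C\<in>rptree_max_cells D S pick \<omega>. S \<inter> closed_ball D x R \<subseteq> C \<and> cell_radius D C \<le> T"
          using C B(4) by (intro bexI[of _ C]) auto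
      qed
    qed (rule sets_Collect_rptree_max_cells[OF S(2) pick])
    finally show ?thesis by simp
  qed
  then show "1 - 1 / 4 < measure (tree_law D) {\<omega> \<in> space (tree_law D). \<exists>C \<in> rptree_max_cells D S pick \<omega>.
      S \<inter> closed_ball D x R \<subseteq> C \<and>
      cell_radius D C \<le> 66189312 * (R * real d * sqrt (real d) * ln (real (max 2 d)))}"
    by (simp only: T_def)
qed

end
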